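(* Let $n\geq3$. Then a closed $(n,3)$-leafed elastica is, up to similarity and reparameterization, uniquely given by an elastic propeller.
   Context: $\mathbf{T}^1:=\mathbf{R}/\mathbf{Z}$; $H^2=W^{2,2}$, and $H^2\hookrightarrow C^1$, so a curve is immersed if its derivative is nowhere zero. For $m\in(0,1)$ let $F(x,m)=\int_0^x\frac{d\theta}{\sqrt{1-m\sin^2\theta}}$, $K(m)=F(\pi/2,m)$, $E(m)=\int_0^{\pi/2}\sqrt{1-m\sin^2\theta}\,d\theta$, $\operatorname{am}(\cdot,m):=F^{-1}(\cdot,m)$ on $\mathbf{R}$, $\operatorname{cn}(x,m):=\cos(\operatorname{am}(x,m))$. Let $m^*\in(0,1)$ be the unique parameter with $K(m^* )=2E(m^* )$ (it satisfies $m^*>1/2$), and let $\phi^*\in(0,\pi/2)$ be the angle with $\cos\phi^*=2m^*-1$. A half-fold figure-eight elastica is an immersed curve $\gamma:[a,b]\to\mathbf{R}^n$ that is contained in a plane and whose signed curvature in that plane, as a function of arclength $s\in[0,L]$ ($L$ its length), is up to the choice of sign $\mathrm{k}(s)=2\sqrt{m^*}\Lambda\operatorname{cn}(\Lambda s-K(m^* ),m^* )$ with $\Lambda=2K(m^* )/L$. (The unit tangents at its two endpoints make the angle $2\phi^*$.) An immersed $H^2$-curve $\gamma:[a,b]\to\mathbf{R}^n$ is a $k$-leafed elastica if there are $a=a_0<a_1<\dots<a_k=b$ such that each $\gamma|_{[a_{i-1},a_i]}$, $i=1,\dots,k$, is a half-fold figure-eight elastica and all these $k$ pieces have the same length. A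 closed $H^2$-curve $\gamma:\mathbf{T}^1\to\mathbf{R}^n$ is a closed $(n,k)$-leafed elastica if there is $t_0\in\mathbf{T}^1$ such that $\tilde\gamma:[0,1]\to\mathbf{R}^n$, $\tilde\gamma(t):=\gamma(t+t_0)$, is a $k$-leafed elastica. Elastic propeller: there are unit vectors $\omega_1,\omega_2,\omega_3\in\mathbf{S}^2\subset\mathbf{R}^3$ with $\langle\omega_i,\omega_j\rangle=\cos2\phi^*$ for all $i\neq j$, and such a triple is unique up to rigid motions. The elastic propeller is the unit-speed closed $(3,3)$-leafed elastica $\gamma:\mathbf{T}^1\to\mathbf{R}^3$ with $\gamma(0)=0$ and $\gamma'(\frac{i}{3})=\omega_i$ for $i=1,2,3$, whose leaves are $\gamma|_{[\frac{i-1}{3},\frac{i}{3}]}$; for $n\geq3$ it is regarded as a curve in $\mathbf{R}^n$ via $\mathbf{R}^3\simeq\mathbf{R}^3\times\{0\}\subset\mathbf{R}^n$. *)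

theory Defs
  imports "HOL-Analysis.Analysis"
begin

section \<open>Elliptic integrals and the parameters of the figure-eight elastica\<close>

(* The interval integral LBINT t=a..b is oriented, so ellF is defined for all real x. *)
definition ellF :: "real \<Rightarrow> real \<Rightarrow> real" where
  "ellF x m = (LBINT \<theta>=0..x. 1 / sqrt (1 - m * (sin \<theta>)\<^sup>2))"

definition ellK :: "real \<Rightarrow> real" where
  "ellK m = ellF (pi / 2) m"

definition ellE :: "real \<Rightarrow> real" where
  "ellE m = (LBINT \<theta>=0..pi / 2. sqrt (1 - m * (sin \<theta>)\<^sup>2))"

definition jacobi_am :: "real \<Rightarrow> real \<Rightarrow> real" where
  "jacobi_am x m = inv (\<lambda>y. ellF y m) x"

definition jacobi_cn :: "real \<Rightarrow> real \<Rightarrow> real" where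
  "jacobi_cn x m = cos (jacobi_am x m)"

definition m_star :: real where
  "m_star = (THE m. 0 < m \<and> m < 1 \<and> ellK m = 2 * ellE m)"

definition phi_star :: real where
  "phi_star = (THE \<phi>. 0 < \<phi> \<and> \<phi> < pi / 2 \<and> cos \<phi> = 2 * m_star - 1)"


section \<open>Sobolev curves\<close>

definition L2_on :: "real \<Rightarrow> real \<Rightarrow> (real \<Rightarrow> 'a::euclidean_space) \<Rightarrow> bool" where
  "L2_on a b u \<longleftrightarrow>
     u \<in> borel_measurable (lebesgue_on {a<..<b}) \<and>
     integrable (lebesgue_on {a<..<b}) (\<lambda>t. (norm (u t))\<^sup>2)"

(* The test functions are those of class C^1 with compact support in the open interval (a,b). *)
definition test_function :: "real \<Rightarrow> real \<Rightarrow> (real \<Rightarrow> real) \<Rightarrow> bool" where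
  "test_function a b \<psi> \<longleftrightarrow>
     (\<forall>t. \<psi> field_differentiable (at t)) \<and> continuous_on UNIV (deriv \<psi>) \<and>
     (\<exists>c d. a < c \<and> d < b \<and> (\<forall>t. t \<notin> {c..d} \<longrightarrow> \<psi> t = 0))"

definition weak_derivative_on ::
  "real \<Rightarrow> real \<Rightarrow> (real \<Rightarrow> 'a::euclidean_space) \<Rightarrow> (real \<Rightarrow> 'a) \<Rightarrow> bool" where
  "weak_derivative_on a b u v \<longleftrightarrow>
     (\<forall>\<psi>. test_function a b \<psi> \<longrightarrow>
        (LINT t|lebesgue_on {a<..<b}. deriv \<psi> t *\<^sub>R u t) =
        - (LINT t|lebesgue_on {a<..<b}. \<psi> t *\<^sub>R v t))"

definition W22_on :: "real \<Rightarrow> real \<Rightarrow> (real \<Rightarrow> 'a::euclidean_space) \<Rightarrow> bool" where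
  "W22_on a b u \<longleftrightarrow>
     L2_on a b u \<and>
     (\<exists>v w. L2_on a b v \<and> L2_on a b w \<and>
        weak_derivative_on a b u v \<and> weak_derivative_on a b v w)"

(* A Sobolev curve is identified with its continuous representative. *)
definition H2_curve :: "real \<Rightarrow> real \<Rightarrow> (real \<Rightarrow> 'a::euclidean_space) \<Rightarrow> bool" where
  "H2_curve a b \<gamma> \<longleftrightarrow> continuous_on {a..b} \<gamma> \<and> W22_on a b \<gamma>"

(* Maps on the circle T^1 = R/Z are represented by 1-periodic maps on R. *)
definition closed_H2_curve :: "(real \<Rightarrow> 'a::euclidean_space) \<Rightarrow> bool" where
  "closed_H2_curve \<gamma> \<longleftrightarrow>
     (\<forall>t. \<gamma> (t + 1) = \<gamma> t) \<and> (\<forall>a b. a < b \<longrightarrow> H2_curve a b \<gamma>)"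


section \<open>Arclength and signed curvature\<close>

(* The derivatives at the endpoints of the parameter interval are one-sided. *)
definition immersed_curve :: "real \<Rightarrow> real \<Rightarrow> (real \<Rightarrow> 'a::euclidean_space) \<Rightarrow> bool" where
  "immersed_curve a b \<gamma> \<longleftrightarrow>
     (\<exists>D. continuous_on {a..b} D \<and>
        (\<forall>t\<in>{a..b}. (\<gamma> has_vector_derivative D t) (at t within {a..b}) \<and> D t \<noteq> 0))"

(* Length of the restriction to [a,t] of a curve defined on [a,b]. *)
definition arclength :: "real \<Rightarrow> real \<Rightarrow> (real \<Rightarrow> 'a::euclidean_space) \<Rightarrow> real \<Rightarrow> real" where
  "arclength a b \<gamma> t =
     integral {a..t} (\<lambda>u. norm (vector_derivative \<gamma> (at u within {a..b})))"

abbreviation curve_length :: "real \<Rightarrow> real \<Rightarrow> (real \<Rightarrow> 'a::euclidean_space) \<Rightarrow> real" where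
  "curve_length a b \<gamma> \<equiv> arclength a b \<gamma> b"

definition orthonormal_pair :: "'a::euclidean_space \<Rightarrow> 'a \<Rightarrow> bool" where
  "orthonormal_pair e\<^sub>1 e\<^sub>2 \<longleftrightarrow> norm e\<^sub>1 = 1 \<and> norm e\<^sub>2 = 1 \<and> e\<^sub>1 \<bullet> e\<^sub>2 = 0"

definition affine_plane :: "'a::euclidean_space \<Rightarrow> 'a \<Rightarrow> 'a \<Rightarrow> 'a set" where
  "affine_plane p e\<^sub>1 e\<^sub>2 = {p + x *\<^sub>R e\<^sub>1 + y *\<^sub>R e\<^sub>2 | x y. True}"

(* Rotation by the angle pi/2 in the plane spanned and oriented by the orthonormal pair. *)
definition rot90 :: "'a::euclidean_space \<Rightarrow> 'a \<Rightarrow> 'a \<Rightarrow> 'a" where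
  "rot90 e\<^sub>1 e\<^sub>2 v = (v \<bullet> e\<^sub>1) *\<^sub>R e\<^sub>2 - (v \<bullet> e\<^sub>2) *\<^sub>R e\<^sub>1"

(* The unit-speed planar curve sigma on [0,L], with tangent T = sigma' and normal N obtained by
   rotating T by pi/2, satisfies sigma'' = k N. *)
definition has_signed_curvature ::
  "'a::euclidean_space \<Rightarrow> 'a \<Rightarrow> real \<Rightarrow> (real \<Rightarrow> 'a) \<Rightarrow> (real \<Rightarrow> real) \<Rightarrow> bool" where
  "has_signed_curvature e\<^sub>1 e\<^sub>2 L \<sigma> k \<longleftrightarrow>
     (\<exists>T. \<forall>s\<in>{0..L}.
        (\<sigma> has_vector_derivative T s) (at s within {0..L}) \<and> norm (T s) = 1 \<and>
        (T has_vector_derivative k s *\<^sub>R rot90 e\<^sub>1 e\<^sub>2 (T s)) (at s within {0..L}))"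


section \<open>Leafed elasticae\<close>

(* sigma is the arclength reparametrization of the curve.  The choice of the sign of the curvature
   is the choice of the orientation of the plane: exchanging the two vectors of the orthonormal
   pair replaces k by -k. *)
definition half_fold_figure_eight ::
  "real \<Rightarrow> real \<Rightarrow> (real \<Rightarrow> 'a::euclidean_space) \<Rightarrow> bool" where
  "half_fold_figure_eight a b \<gamma> \<longleftrightarrow>
     a < b \<and> immersed_curve a b \<gamma> \<and>
     (\<exists>p e\<^sub>1 e\<^sub>2 \<sigma>. orthonormal_pair e\<^sub>1 e\<^sub>2 \<and> \<gamma> ` {a..b} \<subseteq> affine_plane p e\<^sub>1 e\<^sub>2 \<and>
        (\<forall>t\<in>{a..b}. \<gamma> t = \<sigma> (arclength a b \<gamma> t)) \<and>
        (let L = curve_length a b \<gamma>; \<Lambda> = 2 * ellK m_star / L in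
           has_signed_curvature e\<^sub>1 e\<^sub>2 L \<sigma>
             (\<lambda>s. 2 * sqrt m_star * \<Lambda> * jacobi_cn (\<Lambda> * s - ellK m_star) m_star)))"

definition leaf_partition ::
  "real \<Rightarrow> real \<Rightarrow> nat \<Rightarrow> (nat \<Rightarrow> real) \<Rightarrow> (real \<Rightarrow> 'a::euclidean_space) \<Rightarrow> bool" where
  "leaf_partition a b k c \<gamma> \<longleftrightarrow>
     c 0 = a \<and> c k = b \<and>
     (\<forall>i<k. c i < c (Suc i) \<and> half_fold_figure_eight (c i) (c (Suc i)) \<gamma>) \<and>
     (\<forall>i<k. \<forall>j<k. curve_length (c i) (c (Suc i)) \<gamma> = curve_length (c j) (c (Suc j)) \<gamma>)"

definition leafed_elastica ::
  "real \<Rightarrow> real \<Rightarrow> nat \<Rightarrow> (real \<Rightarrow> 'a::euclidean_space) \<Rightarrow> bool" where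
  "leafed_elastica a b k \<gamma> \<longleftrightarrow>
     a < b \<and> H2_curve a b \<gamma> \<and> immersed_curve a b \<gamma> \<and> (\<exists>c. leaf_partition a b k c \<gamma>)"

definition closed_leafed_elastica :: "nat \<Rightarrow> (real \<Rightarrow> 'a::euclidean_space) \<Rightarrow> bool" where
  "closed_leafed_elastica k \<gamma> \<longleftrightarrow>
     closed_H2_curve \<gamma> \<and> (\<exists>t\<^sub>0. leafed_elastica 0 1 k (\<lambda>t. \<gamma> (t + t\<^sub>0)))"


section \<open>Elastic propellers\<close>

definition elastic_propeller :: "(real \<Rightarrow> real ^ 3) \<Rightarrow> bool" where
  "elastic_propeller P \<longleftrightarrow>
     closed_leafed_elastica 3 P \<and>
     (\<forall>t. norm (vector_derivative P (at t)) = 1) \<and>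
     P 0 = 0 \<and>
     (\<exists>\<omega> :: nat \<Rightarrow> real ^ 3.
        (\<forall>i\<in>{1..3}. norm (\<omega> i) = 1) \<and>
        (\<forall>i\<in>{1..3}. \<forall>j\<in>{1..3}. i \<noteq> j \<longrightarrow> \<omega> i \<bullet> \<omega> j = cos (2 * phi_star)) \<and>
        (\<forall>i\<in>{1..3}. (P has_vector_derivative \<omega> i) (at (real i / 3)))) \<and>
     leaf_partition 0 1 3 (\<lambda>i. real i / 3) P"

(* The inclusion of R^3 as a coordinate subspace.  The index type 'n carries no distinguished order,
   hence the coordinates used are given by an injective map \<iota>. *)
definition coord_embedding :: "(3 \<Rightarrow> 'n::finite) \<Rightarrow> real ^ 3 \<Rightarrow> real ^ 'n" where
  "coord_embedding \<iota> x = (\<Sum>i\<in>UNIV. x $ i *\<^sub>R axis (\<iota> i) 1)"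

definition similarity :: "('a::euclidean_space \<Rightarrow> 'a) \<Rightarrow> bool" where
  "similarity S \<longleftrightarrow> (\<exists>r>0. \<forall>x y. dist (S x) (S y) = r * dist x y)"

(* A C^1 diffeomorphism of the circle, given by a lift to the real line; it may preserve or
   reverse the orientation. *)
definition circle_reparam :: "(real \<Rightarrow> real) \<Rightarrow> bool" where
  "circle_reparam \<phi> \<longleftrightarrow>
     (\<forall>t. \<phi> field_differentiable (at t)) \<and> continuous_on UNIV (deriv \<phi>) \<and>
     (\<forall>t. deriv \<phi> t \<noteq> 0) \<and>
     ((\<forall>t. \<phi> (t + 1) = \<phi> t + 1) \<or> (\<forall>t. \<phi> (t + 1) = \<phi> t - 1))"

end

theory Submission
  imports Defs
begin

text \<open>
  The curvature of a half-fold figure-eight is explicit, so the Frenet equations can be integrated in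
  closed form.  With \<open>u = 1 - 2 m sn\<^sup>2\<close> and \<open>v = 2 \<surd>m sn dn\<close>, the unit tangent is
  \<open>u f + v g\<close> for an orthonormal pair \<open>f\<close>, \<open>g\<close>; the equation \<open>K = 2 E\<close> says that the leaf returns to its
  starting point.  Since the two end tangents \<open>w\<close>, \<open>w'\<close> are linearly independent, the leaf is a
  universal function of arclength that depends linearly on \<open>(w, w')\<close>.

  A closed three-leafed elastica is of class \<open>C\<^sup>1\<close>, because a kink would be a Dirac mass in the second
  weak derivative.  Hence the tangents at the three junctions are unit vectors with pairwise inner
  product \<open>cos 2\<phi>\<^sup>*\<close>, and up to translation, scaling and parametrization they determine the curve
  linearly.  Two such triples have the same Gram matrix, so an orthogonal map carries one to the other.
  For existence, such a triple in \<open>\<real>\<^sup>3\<close> requires \<open>cos 2\<phi>\<^sup>* \<ge> - 1/2\<close>, i.e. \<open>m\<^sup>* \<ge> 3/4\<close>, and the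
  resulting curve is of class \<open>C\<^sup>2\<close>, because the curvature vanishes at both ends of a leaf.
\<close>

section \<open>The parameter of the figure-eight\<close>

text \<open>Three leaves are rigid because in a cycle of length three any two directions are
  adjacent, so the junction angle fixes the whole Gram matrix. Positions add no condition: each leaf
  is a loop, hence all junctions are the same point. The threshold 3/4 comes from \<open>1 + 2 * cos
  (2 * phi_star) = (4 * m_star - 1) * (4 * m_star - 3)\<close>: three unit vectors with common inner
  product c have Gram eigenvalues 1 - c and 1 + 2c, and the latter must not be negative. Since
  \<open>m_star\<close> solves a transcendental equation, the bound is obtained by comparing the
  integrand of K - 2E at m = 3/4 pointwise with a function of integral zero. Without it no propeller
  would exist and the uniqueness claim would be empty. Immersion is given only on one period, with
  one-sided derivatives at its ends. The junctions inside the period are therefore of class C^1 by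
  definition, and the absence of kinks has to be proved only at the seam.\<close>

lemma interval_integral_has_real_derivative:
  fixes f :: "real \<Rightarrow> real"
  assumes "continuous_on UNIV f"
  shows "((\<lambda>x. LBINT y=ereal c..ereal x. f y) has_real_derivative f x) (at x)"
proof -
  define a b where "a = min c x - 1" and "b = max c x + 1"
  have "((\<lambda>u. LBINT y=ereal c..ereal u. f y) has_vector_derivative f x) (at x within {a..b})"
    by (rule interval_integral_FTC2) (use assms continuous_on_subset in \<open>auto simp: a_def b_def\<close>)
  moreover have "at x within {a..b} = at x"
    by (rule at_within_interior) (auto simp: a_def b_def)
  ultimately show ?thesis
    by (simp add: has_real_derivative_iff_has_vector_derivative)
qed

lemma elliptic_radicand_pos:
  fixes m :: real
  assumes "m < 1"
  shows "0 < 1 - m * (sin x)\<^sup>2"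
proof -
  have "m * (sin x)\<^sup>2 \<le> max 0 m * 1"
    by (rule mult_mono) (auto simp: abs_square_le_1)
  then show ?thesis using assms by simp
qed

lemma ellF_has_real_derivative:
  assumes "m < 1"
  shows "((\<lambda>x. ellF x m) has_real_derivative 1 / sqrt (1 - m * (sin x)\<^sup>2)) (at x)"
proof -
  have "continuous_on UNIV (\<lambda>x. 1 / sqrt (1 - m * (sin x)\<^sup>2))"
    using elliptic_radicand_pos[OF assms] by (intro continuous_intros) (simp add: less_le)
  then show ?thesis
    unfolding ellF_def zero_ereal_def by (rule interval_integral_has_real_derivative)
qed

text \<open>The incomplete integral of the second kind; the first coordinate of the leaf needs it at
  a variable amplitude.\<close>

definition ellE_inc :: "real \<Rightarrow> real \<Rightarrow> real" where
  "ellE_inc x m = (LBINT \<theta>=0..x. sqrt (1 - m * (sin \<theta>)\<^sup>2))"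

lemma ellE_inc_has_real_derivative:
  "((\<lambda>x. ellE_inc x m) has_real_derivative sqrt (1 - m * (sin x)\<^sup>2)) (at x)"
  unfolding ellE_inc_def zero_ereal_def
  by (rule interval_integral_has_real_derivative) (intro continuous_intros)

lemma ellE_eq_ellE_inc: "ellE m = ellE_inc (pi / 2) m"
  by (simp add: ellE_def ellE_inc_def)

lemma ellF_0: "ellF 0 m = 0" and ellE_inc_0: "ellE_inc 0 m = 0"
  by (simp_all add: ellF_def ellE_inc_def zero_ereal_def)

lemma odd_if_even_derivative:
  fixes f :: "real \<Rightarrow> real"
  assumes "\<And>x. (f has_real_derivative f' x) (at x)" "\<And>x. f' (- x) = f' x" "f 0 = 0"
  shows "f (- x) = - f x"
proof -
  have "((\<lambda>x. f (- x) + f x) has_real_derivative 0) (at x)" for x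
    using DERIV_add[OF DERIV_chain2[OF assms(1) DERIV_minus[OF DERIV_ident]] assms(1)] assms(2)
    by simp
  then have "f (- x) + f x = f (- 0) + f 0"
    by (rule DERIV_isconst_all[rule_format])
  then show ?thesis using assms(3) by simp
qed

lemma ellF_minus: "m < 1 \<Longrightarrow> ellF (- x) m = - ellF x m"
  by (rule odd_if_even_derivative[OF ellF_has_real_derivative]) (auto simp: ellF_0)

lemma ellE_inc_minus: "ellE_inc (- x) m = - ellE_inc x m"
  by (rule odd_if_even_derivative[OF ellE_inc_has_real_derivative]) (auto simp: ellE_inc_0)

section \<open>The zero of K - 2E\<close>

lemma ellK_minus_ellE_has_integral:
  assumes "m < 1"
  shows "((\<lambda>x. 1 / sqrt (1 - m * (sin x)\<^sup>2) - 2 * sqrt (1 - m * (sin x)\<^sup>2))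
    has_integral (ellK m - 2 * ellE m)) {0..pi / 2}"
proof -
  have "((\<lambda>x. 1 / sqrt (1 - m * (sin x)\<^sup>2) - 2 * sqrt (1 - m * (sin x)\<^sup>2))
    has_integral ((ellF (pi/2) m - 2 * ellE_inc (pi/2) m) - (ellF 0 m - 2 * ellE_inc 0 m))) {0..pi / 2}"
    by (rule fundamental_theorem_of_calculus)
      (auto simp flip: has_real_derivative_iff_has_vector_derivative
        intro!: DERIV_subset[OF ellF_has_real_derivative[OF assms]]
        DERIV_cmult DERIV_subset[OF ellE_inc_has_real_derivative] derivative_intros)
  then show ?thesis
    by (simp add: ellF_0 ellE_inc_0 ellK_def ellE_eq_ellE_inc)
qed

text \<open>Makes the zero of K - 2E unique. With p and q the radicals for m and m', the integrands
  differ by at least 2(p - q), and p + q is at most 2, so the difference is at least (m' - m) sin^2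
  x. The integral of sin^2 over the quarter period is pi/4, with antiderivative
  \<open>J\<close>.\<close>

lemma ellK_minus_ellE_strict_mono:
  assumes "0 \<le> m" "m < m'" "m' < 1"
  shows "ellK m - 2 * ellE m < ellK m' - 2 * ellE m'"
proof -
  define J where "J = (\<lambda>x::real. (x - sin x * cos x) / 2)"
  have "((\<lambda>x. (m' - m) * (sin x)\<^sup>2) has_integral ((m' - m) * J (pi/2) - (m' - m) * J 0)) {0..pi/2}"
    unfolding J_def
    by (rule fundamental_theorem_of_calculus)
      (auto simp flip: has_real_derivative_iff_has_vector_derivative
        intro!: derivative_eq_intros simp: power2_eq_square[symmetric] cos_squared_eq)
  then have "((\<lambda>x. (m' - m) * (sin x)\<^sup>2) has_integral ((m' - m) * (pi / 4))) {0..pi/2}"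
    by (simp add: J_def)
  moreover have "((\<lambda>x. (1 / sqrt (1 - m' * (sin x)\<^sup>2) - 2 * sqrt (1 - m' * (sin x)\<^sup>2)) -
      (1 / sqrt (1 - m * (sin x)\<^sup>2) - 2 * sqrt (1 - m * (sin x)\<^sup>2)))
    has_integral (ellK m' - 2 * ellE m') - (ellK m - 2 * ellE m)) {0..pi / 2}"
    using assms by (intro has_integral_diff ellK_minus_ellE_has_integral) auto
  moreover have "(m' - m) * (sin x)\<^sup>2 \<le> (1 / sqrt (1 - m' * (sin x)\<^sup>2) - 2 * sqrt (1 - m' * (sin x)\<^sup>2)) -
      (1 / sqrt (1 - m * (sin x)\<^sup>2) - 2 * sqrt (1 - m * (sin x)\<^sup>2))" for x
  proof -
    define p q where "p = sqrt (1 - m * (sin x)\<^sup>2)" and "q = sqrt (1 - m' * (sin x)\<^sup>2)"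
    have "0 < q" using assms elliptic_radicand_pos[of m' x] by (simp add: q_def)
    moreover have "q \<le> p" using assms by (auto simp: p_def q_def intro!: mult_right_mono)
    ultimately have "1 / p \<le> 1 / q" by (simp add: frac_le)
    have "p \<le> 1" using assms by (simp add: p_def)
    then have "(p - q) * (p + q) \<le> (p - q) * 2"
      using \<open>q \<le> p\<close> by (intro mult_left_mono) auto
    moreover have "p\<^sup>2 = 1 - m * (sin x)\<^sup>2" "q\<^sup>2 = 1 - m' * (sin x)\<^sup>2"
      using assms elliptic_radicand_pos[of m x] elliptic_radicand_pos[of m' x]
      by (auto simp: p_def q_def)
    then have "(p - q) * (p + q) = (m' - m) * (sin x)\<^sup>2"
      by (simp add: algebra_simps power2_eq_square)
    ultimately show ?thesis
      using \<open>1 / p \<le> 1 / q\<close> unfolding p_def q_def by argo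
  qed
  ultimately have "(m' - m) * (pi / 4) \<le> (ellK m' - 2 * ellE m') - (ellK m - 2 * ellE m)"
    by (rule has_integral_le)
  moreover have "0 < (m' - m) * (pi / 4)" using assms by simp
  ultimately show ?thesis by linarith
qed
lemma continuous_on_ellK_minus_ellE: "continuous_on {..<1} (\<lambda>m. ellK m - 2 * ellE m)"
proof -
  define h where
    "h = (\<lambda>m x::real. 1 / sqrt (1 - m * (sin x)\<^sup>2) - 2 * sqrt (1 - m * (sin x)\<^sup>2))"
  have "continuous_on ({..<1} \<times> cbox 0 (pi / 2)) (\<lambda>(m, x). h m x)"
    unfolding h_def case_prod_unfold
    by (intro continuous_intros) (use elliptic_radicand_pos in \<open>force simp: less_le\<close>)
  then have "continuous_on {..<1} (\<lambda>m. integral (cbox 0 (pi / 2)) (h m))"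
    by (rule integral_continuous_on_param)
  moreover have "integral (cbox 0 (pi / 2)) (h m) = ellK m - 2 * ellE m" if "m \<in> {..<1}" for m
    using ellK_minus_ellE_has_integral[of m] that by (auto simp: h_def integral_unique)
  ultimately show ?thesis
    by (rule continuous_on_eq)
qed

text \<open>Places the zero at or above 3/4: the integrand of K - 2E is bounded by
  \<open>- cos (2 * x)\<close>, which integrates to 0.\<close>

lemma ellK_three_quarters_le: "ellK (3/4) \<le> 2 * ellE (3/4)"
proof -
  have "((\<lambda>x. - cos (2 * x)) has_integral (- sin (2 * (pi/2)) / 2 - (- sin (2 * 0) / 2))) {0..pi/2}"
    by (rule fundamental_theorem_of_calculus)
      (auto simp flip: has_real_derivative_iff_has_vector_derivative intro!: derivative_eq_intros)
  then have "((\<lambda>x. - cos (2 * x)) has_integral 0) {0..pi/2}" by simp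
  then have "ellK (3/4) - 2 * ellE (3/4) \<le> 0"
  proof (rule has_integral_le[rotated])
    \<comment> \<open>\<open>cos (2 * x)\<close> is the chord over \<open>[1/4, 1]\<close> of the concave function
      \<open>2 * sqrt q - 1 / sqrt q\<close>, evaluated at \<open>q = 1 - 3/4 * (sin x)\<^sup>2\<close>\<close>
    show "1 / sqrt (1 - 3/4 * (sin x)\<^sup>2) - 2 * sqrt (1 - 3/4 * (sin x)\<^sup>2) \<le> - cos (2 * x)" for x
    proof -
      define y where "y = sqrt (1 - 3/4 * (sin x)\<^sup>2)"
      have s: "(sin x)\<^sup>2 \<le> 1" by (simp add: abs_square_le_1)
      have y2: "y\<^sup>2 = 1 - 3/4 * (sin x)\<^sup>2" using s by (simp add: y_def)
      have "1/2 \<le> y" unfolding y_def using s by (intro real_le_rsqrt) (simp add: power2_eq_square)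
      moreover have "y \<le> 1" by (simp add: y_def)
      ultimately have "(1 - y) * (2 * y - 1) * (4 * y + 3) \<ge> 0" by simp
      then have "3 \<le> 3 * y * (2 * y - (8 * y\<^sup>2 - 5) / 3)"
        by (simp add: field_simps power2_eq_square)
      then have "1 / y \<le> 2 * y - (8 * y\<^sup>2 - 5) / 3"
        using \<open>1/2 \<le> y\<close> by (simp add: field_simps)
      moreover have "(8 * y\<^sup>2 - 5) / 3 = cos (2 * x)"
        unfolding y2 cos_double_sin by simp
      ultimately show ?thesis unfolding y_def by linarith
    qed
  qed (use ellK_minus_ellE_has_integral[of "3/4"] in auto)
  then show ?thesis by simp
qed

lemma ellE_le: "0 \<le> m \<Longrightarrow> ellE m \<le> pi / 2"
proof -
  assume "0 \<le> m"
  have "((\<lambda>x. sqrt (1 - m * (sin x)\<^sup>2)) has_integral (ellE_inc (pi/2) m - ellE_inc 0 m)) {0..pi / 2}"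
    by (rule fundamental_theorem_of_calculus)
      (auto simp flip: has_real_derivative_iff_has_vector_derivative
        intro!: DERIV_subset[OF ellE_inc_has_real_derivative])
  then have "((\<lambda>x. sqrt (1 - m * (sin x)\<^sup>2)) has_integral ellE m) {0..pi / 2}"
    by (simp add: ellE_inc_0 ellE_eq_ellE_inc)
  moreover have "((\<lambda>x::real. 1::real) has_integral (pi / 2)) {0..pi/2}"
    using has_integral_const_real[of "1::real" 0 "pi/2"] by simp
  ultimately show ?thesis
    by (rule has_integral_le) (use \<open>0 \<le> m\<close> in simp)
qed

text \<open>The logarithmic blow-up of K at m = 1. Since
  \<open>1 - (1 - \<eta>\<^sup>2) * (sin x)\<^sup>2\<close> equals
  \<open>(cos x)\<^sup>2 + \<eta>\<^sup>2 * (sin x)\<^sup>2\<close>, its root is at most cos x +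
  \<eta>, and cos x is at most pi/2 - x.\<close>

lemma ellK_ge_ln:
  assumes "0 < \<eta>" "\<eta> < 1"
  shows "ln (1 + pi / (2 * \<eta>)) \<le> ellK (1 - \<eta>\<^sup>2)"
proof -
  have \<eta>: "1 - \<eta>\<^sup>2 < 1" using assms by simp
  have "((\<lambda>x. 1 / (pi/2 - x + \<eta>)) has_integral
      (- ln (pi/2 - pi/2 + \<eta>) - (- ln (pi/2 - 0 + \<eta>)))) {0..pi/2}"
    by (rule fundamental_theorem_of_calculus)
      (use assms in \<open>auto simp flip: has_real_derivative_iff_has_vector_derivative
        intro!: derivative_eq_intros\<close>)
  moreover have "- ln (pi/2 - pi/2 + \<eta>) - (- ln (pi/2 - 0 + \<eta>)) = ln (1 + pi / (2 * \<eta>))"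
  proof -
    have "1 + pi / (2 * \<eta>) = (pi/2 + \<eta>) / \<eta>" using assms by (simp add: field_simps)
    moreover have "0 < pi/2 + \<eta>" using assms by (simp add: add_pos_pos)
    ultimately show ?thesis using assms by (simp add: ln_div)
  qed
  ultimately have 1: "((\<lambda>x. 1 / (pi/2 - x + \<eta>)) has_integral ln (1 + pi / (2 * \<eta>))) {0..pi/2}"
    by simp
  have "((\<lambda>x. 1 / sqrt (1 - (1 - \<eta>\<^sup>2) * (sin x)\<^sup>2)) has_integral
      (ellF (pi/2) (1 - \<eta>\<^sup>2) - ellF 0 (1 - \<eta>\<^sup>2))) {0..pi / 2}"
    by (rule fundamental_theorem_of_calculus)
      (auto simp flip: has_real_derivative_iff_has_vector_derivative
        intro!: DERIV_subset[OF ellF_has_real_derivative[OF \<eta>]])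
  then have 2: "((\<lambda>x. 1 / sqrt (1 - (1 - \<eta>\<^sup>2) * (sin x)\<^sup>2)) has_integral ellK (1 - \<eta>\<^sup>2)) {0..pi/2}"
    by (simp add: ellF_0 ellK_def)
  show ?thesis
  proof (rule has_integral_le[OF 1 2])
    fix x :: real assume x: "x \<in> {0..pi/2}"
    have "cos x = sin (pi/2 - x)" by (simp add: sin_diff)
    also have "\<dots> \<le> pi/2 - x" using x by (intro sin_x_le_x) auto
    finally have "cos x \<le> pi/2 - x" .
    have "0 \<le> cos x" using x by (intro cos_ge_zero) auto
    have "1 - (1 - \<eta>\<^sup>2) * (sin x)\<^sup>2 = (cos x)\<^sup>2 + \<eta>\<^sup>2 * (sin x)\<^sup>2"
      by (simp add: cos_squared_eq algebra_simps)
    also have "\<dots> \<le> (cos x)\<^sup>2 + \<eta>\<^sup>2 * 1"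
      by (intro add_left_mono mult_left_mono) (auto simp: abs_square_le_1)
    also have "\<dots> \<le> (cos x + \<eta>)\<^sup>2"
      using \<open>0 \<le> cos x\<close> assms by (simp add: power2_sum)
    finally have "sqrt (1 - (1 - \<eta>\<^sup>2) * (sin x)\<^sup>2) \<le> cos x + \<eta>"
      using \<open>0 \<le> cos x\<close> assms by (intro real_le_lsqrt) auto
    also have "\<dots> \<le> pi/2 - x + \<eta>" using \<open>cos x \<le> pi/2 - x\<close> by simp
    finally show "1 / (pi/2 - x + \<eta>) \<le> 1 / sqrt (1 - (1 - \<eta>\<^sup>2) * (sin x)\<^sup>2)"
      using elliptic_radicand_pos[OF \<eta>, of x] x assms
      by (intro divide_left_mono) (auto intro!: mult_pos_pos)
  qed
qed

lemma ellK_gt_ellE_near_1: "2 * ellE (1 - exp (- 8)) < ellK (1 - exp (- 8))"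
proof -
  \<comment> \<open>Chosen so that ln(1/\<eta>) = 4 exceeds pi, which bounds 2E.\<close>
  define \<eta> :: real where "\<eta> = exp (- 4)"
  have \<eta>: "0 < \<eta>" "\<eta> < 1" "\<eta>\<^sup>2 = exp (- 8)"
    by (auto simp: \<eta>_def power2_eq_square exp_add[symmetric])
  have "pi < 4" by (rule pi_less_4)
  also have "4 = ln (1 / \<eta>)" by (simp add: \<eta>_def ln_div)
  also have "\<dots> \<le> ln (1 + pi / (2 * \<eta>))"
    using \<eta> pi_gt3 by (subst ln_le_cancel_iff) (auto simp: field_simps add_pos_pos)
  also have "\<dots> \<le> ellK (1 - \<eta>\<^sup>2)" using ellK_ge_ln \<eta>(1,2) by simp
  finally have "pi < ellK (1 - exp (- 8))" unfolding \<eta>(3) .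
  moreover have "ellE (1 - exp (- 8)) \<le> pi / 2" by (intro ellE_le) simp
  ultimately show ?thesis by linarith
qed

text \<open>The intermediate value theorem on [3/4, 1 - exp(-8)] gives a zero of K - 2E, and
  monotonicity identifies it with the value of the definite description, so existence and the lower
  bound come together.\<close>

lemma m_star_props: "3/4 \<le> m_star" "m_star < 1" "ellK m_star = 2 * ellE m_star"
proof -
  have "exp (- 8) \<le> (1/9 :: real)"
    using exp_ge_add_one_self[of 8] by (simp add: exp_minus field_simps)
  then have "\<exists>m\<ge>3/4. m \<le> 1 - exp (- 8) \<and> ellK m - 2 * ellE m = 0"
    using ellK_three_quarters_le ellK_gt_ellE_near_1
    by (intro IVT' continuous_on_subset[OF continuous_on_ellK_minus_ellE]) (auto intro: le_less_trans)
  then obtain m where m: "3/4 \<le> m" "m \<le> 1 - exp (- 8)" "ellK m - 2 * ellE m = 0" by blast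
  have "m < 1" using m(2) exp_gt_zero[of "- 8 :: real"] by linarith
  have "m_star = m" unfolding m_star_def
  proof (rule the_equality)
    show "m' = m" if "0 < m' \<and> m' < 1 \<and> ellK m' = 2 * ellE m'" for m'
      using ellK_minus_ellE_strict_mono[of m m'] ellK_minus_ellE_strict_mono[of m' m] that m \<open>m < 1\<close>
      by (cases m m' rule: linorder_cases) auto
  qed (use m \<open>m < 1\<close> in auto)
  then show "3/4 \<le> m_star" "m_star < 1" "ellK m_star = 2 * ellE m_star"
    using m \<open>m < 1\<close> by auto
qed

lemma phi_star_cos: "cos (2 * phi_star) = 8 * m_star\<^sup>2 - 8 * m_star + 1"
proof -
  have ms: "0 < 2 * m_star - 1" "2 * m_star - 1 < 1" using m_star_props by auto
  have "phi_star = arccos (2 * m_star - 1)" unfolding phi_star_def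
  proof (rule the_equality)
    show "0 < arccos (2 * m_star - 1) \<and> arccos (2 * m_star - 1) < pi / 2 \<and>
        cos (arccos (2 * m_star - 1)) = 2 * m_star - 1"
      using ms arccos_less_arccos[of 0 "2 * m_star - 1"] arccos_less_arccos[of "2 * m_star - 1" 1] by auto
    show "\<phi> = arccos (2 * m_star - 1)" if "0 < \<phi> \<and> \<phi> < pi / 2 \<and> cos \<phi> = 2 * m_star - 1" for \<phi>
      using that arccos_cos[of \<phi>] by simp
  qed
  moreover have "cos (arccos (2 * m_star - 1)) = 2 * m_star - 1"
    by (rule cos_arccos) (use ms in linarith)+
  ultimately have "cos phi_star = 2 * m_star - 1" by simp
  then show ?thesis unfolding cos_double_cos \<open>cos phi_star = 2 * m_star - 1\<close> by (simp add: power2_eq_square algebra_simps)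
qed

section \<open>The explicit leaf\<close>

lemma ellF_strict_mono: "m < 1 \<Longrightarrow> strict_mono (\<lambda>x. ellF x m)"
  using DERIV_pos_imp_increasing[of _ _ "\<lambda>x. ellF x m"] ellF_has_real_derivative[of m]
    elliptic_radicand_pos[of m]
  by (intro strict_monoI) (metis real_sqrt_gt_zero zero_less_divide_1_iff)

lemma ellF_ge_self:
  assumes "0 \<le> m" "m < 1" "0 \<le> x"
  shows "x \<le> ellF x m"
proof -
  have "ellF 0 m - 0 \<le> ellF x m - x"
  proof (rule DERIV_nonneg_imp_nondecreasing[OF \<open>0 \<le> x\<close>])
    fix t :: real
    have "1 \<le> 1 / sqrt (1 - m * (sin t)\<^sup>2)"
      using assms elliptic_radicand_pos[of m t] by simp
    then show "\<exists>y. ((\<lambda>x. ellF x m - x) has_real_derivative y) (at t) \<and> 0 \<le> y"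
      using DERIV_diff[OF ellF_has_real_derivative[OF \<open>m < 1\<close>] DERIV_ident, of t]
      by (intro exI conjI) auto
  qed
  then show ?thesis by (simp add: ellF_0)
qed

text \<open>Turns the \<open>inv\<close> in \<open>jacobi_am\<close> into a genuine inverse. The
  integrand is at least 1, so F takes at -|y| and |y| values that enclose y.\<close>

lemma bij_ellF:
  assumes "0 \<le> m" "m < 1"
  shows "bij (\<lambda>x. ellF x m)"
proof (rule bijI)
  show "inj (\<lambda>x. ellF x m)"
    using ellF_strict_mono[OF \<open>m < 1\<close>] by (rule strict_mono_imp_inj_on)
  show "surj (\<lambda>x. ellF x m)"
  proof (rule surjI)
    fix y :: real
    have "\<exists>x. - \<bar>y\<bar> \<le> x \<and> x \<le> \<bar>y\<bar> \<and> ellF x m = y"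
      using ellF_ge_self[OF assms, of "\<bar>y\<bar>"] ellF_minus[OF \<open>m < 1\<close>, of "\<bar>y\<bar>"]
      by (intro IVT) (auto intro: DERIV_isCont[OF ellF_has_real_derivative[OF \<open>m < 1\<close>]])
    then show "ellF (inv (\<lambda>x. ellF x m) y) m = y"
      by (metis f_inv_into_f rangeI)
  qed
qed

lemma ellF_jacobi_am: "0 \<le> m \<Longrightarrow> m < 1 \<Longrightarrow> ellF (jacobi_am y m) m = y"
  unfolding jacobi_am_def using bij_ellF[of m] by (metis bij_inv_eq_iff)

lemma jacobi_am_ellF: "0 \<le> m \<Longrightarrow> m < 1 \<Longrightarrow> jacobi_am (ellF x m) m = x"
  unfolding jacobi_am_def using bij_ellF[of m] by (metis bij_inv_eq_iff)

text \<open>The derivative is the Jacobi function dn, the reciprocal of the derivative of F at the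
  amplitude.\<close>

lemma jacobi_am_has_real_derivative:
  assumes "0 \<le> m" "m < 1"
  shows "((\<lambda>y. jacobi_am y m) has_real_derivative sqrt (1 - m * (sin (jacobi_am y m))\<^sup>2)) (at y)"
proof -
  have "isCont (\<lambda>y. jacobi_am y m) (ellF (jacobi_am y m) m)"
    by (rule isCont_inverse_function[where f = "\<lambda>x. ellF x m" and d = 1])
      (auto simp: assms jacobi_am_ellF intro: DERIV_isCont[OF ellF_has_real_derivative[OF \<open>m < 1\<close>]])
  then have "isCont (\<lambda>y. jacobi_am y m) y" by (simp add: assms ellF_jacobi_am)
  then have "((\<lambda>y. jacobi_am y m) has_real_derivative
      inverse (1 / sqrt (1 - m * (sin (jacobi_am y m))\<^sup>2))) (at y)"
    using elliptic_radicand_pos[OF \<open>m < 1\<close>, of "jacobi_am y m"]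
    by (intro DERIV_inverse_function[where f = "\<lambda>x. ellF x m" and a = "y - 1" and b = "y + 1"]
         ellF_has_real_derivative)
      (auto simp: assms ellF_jacobi_am)
  then show ?thesis by simp
qed

abbreviation K_star :: real where "K_star \<equiv> ellK m_star"
abbreviation am_star :: "real \<Rightarrow> real" where "am_star y \<equiv> jacobi_am y m_star"

lemma m_star_bounds: "0 \<le> m_star" "m_star < 1" "0 < m_star" "1/2 < m_star"
  using m_star_props by auto

lemma K_star_pos: "0 < K_star"
  using ellF_ge_self[of m_star "pi/2"] m_star_bounds pi_gt_zero unfolding ellK_def by linarith

lemma am_star_K: "am_star K_star = pi/2" "am_star (- K_star) = - (pi/2)"
  using m_star_bounds jacobi_am_ellF[of m_star "pi/2"] jacobi_am_ellF[of m_star "- (pi/2)"]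
  by (simp_all add: ellK_def ellF_minus)

lemmas am_star_has_real_derivative =
  jacobi_am_has_real_derivative[OF m_star_bounds(1,2)]

section \<open>The model leaf in the plane, parametrized by arclength on [-K, K]\<close>

definition curv :: "real \<Rightarrow> real" where
  "curv y = 2 * sqrt m_star * cos (am_star y)"

text \<open>With \<open>tan_y\<close>, the cosine and sine of the tangent angle \<theta> given by
  sin(\<theta>/2) = sqrt m sn and cos(\<theta>/2) = dn. Differentiating the first relation gives
  \<theta>' = 2 sqrt m cn, which is \<open>curv\<close>.\<close>

definition tan_x :: "real \<Rightarrow> real" where
  "tan_x y = 1 - 2 * m_star * (sin (am_star y))\<^sup>2"

definition tan_y :: "real \<Rightarrow> real" where
  "tan_y y = 2 * sqrt m_star * sin (am_star y) * sqrt (1 - m_star * (sin (am_star y))\<^sup>2)"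

text \<open>An antiderivative of \<open>tan_x\<close>, because 1 - 2m sn^2 = 2 dn^2 - 1 and the
  derivative of E(am y) is dn^2.\<close>

definition pos_x :: "real \<Rightarrow> real" where
  "pos_x y = 2 * ellE_inc (am_star y) m_star - y"

text \<open>The curvature of an elastica is proportional to the distance from an axis; here the
  factor is -1, since the derivative of \<open>curv\<close> is \<open>- tan_y\<close>.\<close>

definition pos_y :: "real \<Rightarrow> real" where
  "pos_y y = - curv y"

lemma sqrt_radicand_squared: "(sqrt (1 - m_star * (sin x)\<^sup>2))\<^sup>2 = 1 - m_star * (sin x)\<^sup>2"
  using elliptic_radicand_pos[OF m_star_bounds(2), of x] by simp

lemma curv_has_real_derivative: "(curv has_real_derivative - tan_y y) (at y)"
  unfolding curv_def tan_y_def
  by (auto intro!: derivative_eq_intros am_star_has_real_derivative)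

lemma pos_y_has_real_derivative: "(pos_y has_real_derivative tan_y y) (at y)"
  unfolding pos_y_def using DERIV_minus[OF curv_has_real_derivative] by simp

lemma pos_x_has_real_derivative: "(pos_x has_real_derivative tan_x y) (at y)"
  unfolding pos_x_def tan_x_def
  using sqrt_radicand_squared[of "am_star y"]
  by (auto intro!: derivative_eq_intros am_star_has_real_derivative
      DERIV_chain2[OF ellE_inc_has_real_derivative] simp: power2_eq_square)

lemma tan_x_has_real_derivative: "(tan_x has_real_derivative - curv y * tan_y y) (at y)"
  unfolding tan_x_def curv_def tan_y_def
  using m_star_bounds
  by (auto intro!: derivative_eq_intros am_star_has_real_derivative)

lemma tan_y_has_real_derivative: "(tan_y has_real_derivative curv y * tan_x y) (at y)"
proof -
  define s c d where "s = sin (am_star y)" and "c = cos (am_star y)"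
    and "d = sqrt (1 - m_star * s\<^sup>2)"
  have d: "0 < d" "d\<^sup>2 = 1 - m_star * s\<^sup>2"
    using elliptic_radicand_pos[OF m_star_bounds(2), of "am_star y"] by (auto simp: d_def s_def)
  have "((\<lambda>y. 1 - m_star * (sin (am_star y))\<^sup>2) has_real_derivative - (m_star * (2 * s * (c * d)))) (at y)"
    unfolding s_def c_def d_def by (auto intro!: derivative_eq_intros am_star_has_real_derivative)
  then have "((\<lambda>y. sqrt (1 - m_star * (sin (am_star y))\<^sup>2)) has_real_derivative
      inverse d / 2 * - (m_star * (2 * s * (c * d)))) (at y)"
    unfolding d_def s_def
    by (rule DERIV_chain2[OF DERIV_real_sqrt, rotated]) (rule elliptic_radicand_pos[OF m_star_bounds(2)])
  also have "inverse d / 2 * - (m_star * (2 * s * (c * d))) = - m_star * s * c"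
    using d(1) by (simp add: field_simps)
  finally have rad: "((\<lambda>y. sqrt (1 - m_star * (sin (am_star y))\<^sup>2)) has_real_derivative - m_star * s * c) (at y)" .
  have "((\<lambda>y. 2 * sqrt m_star * sin (am_star y)) has_real_derivative 2 * sqrt m_star * (c * d)) (at y)"
    by (auto intro!: derivative_eq_intros am_star_has_real_derivative simp: s_def c_def d_def)
  from DERIV_mult[OF this rad] have "(tan_y has_real_derivative
      2 * sqrt m_star * s * (- m_star * s * c) + 2 * sqrt m_star * (c * d) * d) (at y)"
    unfolding tan_y_def by (simp add: s_def d_def algebra_simps)
  also have "2 * sqrt m_star * s * (- m_star * s * c) + 2 * sqrt m_star * (c * d) * d
      = 2 * sqrt m_star * c * (d\<^sup>2 - m_star * s\<^sup>2)"
    by (simp add: algebra_simps power2_eq_square)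
  also have "\<dots> = curv y * tan_x y"
    by (simp add: curv_def tan_x_def d(2) flip: s_def c_def)
  finally show ?thesis .
qed

lemma tan_unit: "(tan_x y)\<^sup>2 + (tan_y y)\<^sup>2 = 1"
  using m_star_bounds
  by (simp add: tan_x_def tan_y_def power_mult_distrib sqrt_radicand_squared)
    (simp add: algebra_simps power2_eq_square)

lemma curv_K: "curv K_star = 0" "curv (- K_star) = 0"
  by (simp_all add: curv_def am_star_K)

text \<open>Here the equation K = 2E is used: the first coordinate at K is 2E - K. The second
  coordinate vanishes because cn does.\<close>

lemma pos_K: "pos_x K_star = 0" "pos_x (- K_star) = 0" "pos_y K_star = 0" "pos_y (- K_star) = 0"
proof -
  have "2 * ellE_inc (pi / 2) m_star = K_star"
    using m_star_props(3) by (simp add: ellE_eq_ellE_inc)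
  then show "pos_x K_star = 0" "pos_x (- K_star) = 0" "pos_y K_star = 0" "pos_y (- K_star) = 0"
    by (simp_all add: pos_x_def pos_y_def curv_K am_star_K ellE_inc_minus)
qed

text \<open>With \<open>end_y\<close>, the cosine and sine of pi - \<open>phi_star\<close>, the
  tangent angle at K. At -K the angle is the opposite one, so up to full turns the end tangents
  differ by 2 \<open>phi_star\<close>.\<close>

definition end_x :: real where "end_x = 1 - 2 * m_star"
definition end_y :: real where "end_y = 2 * sqrt m_star * sqrt (1 - m_star)"

lemma tan_K: "tan_x K_star = end_x" "tan_x (- K_star) = end_x"
  "tan_y K_star = end_y" "tan_y (- K_star) = - end_y"
  by (simp_all add: tan_x_def tan_y_def end_x_def end_y_def am_star_K)

lemma end_nonzero: "end_x < 0" "0 < end_y"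
  using m_star_bounds by (auto simp: end_x_def end_y_def)

lemma end_unit: "end_x\<^sup>2 + end_y\<^sup>2 = 1"
  using tan_unit[of K_star] by (simp add: tan_K)

lemma end_angle: "end_x\<^sup>2 - end_y\<^sup>2 = cos (2 * phi_star)"
  using m_star_bounds
  by (simp add: phi_star_cos end_x_def end_y_def power_mult_distrib)
    (simp add: algebra_simps power2_eq_square)

text \<open>With \<open>axis_y\<close>, the solution f, g of w = \<open>end_x\<close> f -
  \<open>end_y\<close> g and w' = \<open>end_x\<close> f + \<open>end_y\<close> g. This recovers the
  frame linearly from the two end tangents.\<close>

definition axis_x :: "'a::euclidean_space \<Rightarrow> 'a \<Rightarrow> 'a" where
  "axis_x w w' = (1 / (2 * end_x)) *\<^sub>R (w + w')"

definition axis_y :: "'a::euclidean_space \<Rightarrow> 'a \<Rightarrow> 'a" where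
  "axis_y w w' = (1 / (2 * end_y)) *\<^sub>R (w' - w)"

text \<open>The inner product of w and w' is \<open>end_x\<^sup>2 - end_y\<^sup>2\<close>, so w + w'
  and w' - w have squared norms \<open>4 * end_x\<^sup>2\<close> and
  \<open>4 * end_y\<^sup>2\<close>; they are orthogonal because w and w' have equal length.\<close>

lemma orthonormal_pair_axes:
  assumes "norm w = 1" "norm w' = 1" "w \<bullet> w' = cos (2 * phi_star)"
  shows "orthonormal_pair (axis_x w w') (axis_y w w')"
proof -
  have w: "w \<bullet> w = 1" "w' \<bullet> w' = 1" "w \<bullet> w' = end_x\<^sup>2 - end_y\<^sup>2" "w' \<bullet> w = end_x\<^sup>2 - end_y\<^sup>2"
    using assms by (auto simp: norm_eq_1 end_angle inner_commute)
  have y2: "end_y\<^sup>2 = 1 - end_x\<^sup>2" and x2: "end_x\<^sup>2 = 1 - end_y\<^sup>2" using end_unit by auto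
  have "axis_x w w' \<bullet> axis_x w w' = 1"
    using end_nonzero by (simp add: axis_x_def inner_simps w y2) (simp add: field_simps power2_eq_square)
  moreover have "axis_y w w' \<bullet> axis_y w w' = 1"
    using end_nonzero by (simp add: axis_y_def inner_simps w x2) (simp add: field_simps power2_eq_square)
  moreover have "axis_x w w' \<bullet> axis_y w w' = 0"
    by (simp add: axis_x_def axis_y_def inner_simps w)
  ultimately show ?thesis by (simp add: orthonormal_pair_def norm_eq_1)
qed

lemma axes_tangents:
  "end_x *\<^sub>R axis_x w w' - end_y *\<^sub>R axis_y w w' = w"
  "end_x *\<^sub>R axis_x w w' + end_y *\<^sub>R axis_y w w' = w'"
proof -
  have "w = (1/2) *\<^sub>R (w + w') - (1/2) *\<^sub>R (w' - w)" "w' = (1/2) *\<^sub>R (w + w') + (1/2) *\<^sub>R (w' - w)"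
    by (simp_all add: algebra_simps flip: scaleR_add_left)
  then show "end_x *\<^sub>R axis_x w w' - end_y *\<^sub>R axis_y w w' = w"
    "end_x *\<^sub>R axis_x w w' + end_y *\<^sub>R axis_y w w' = w'"
    using end_nonzero by (simp_all add: axis_x_def axis_y_def)
qed

lemma axes_of_frame:
  "axis_x (end_x *\<^sub>R f - end_y *\<^sub>R g) (end_x *\<^sub>R f + end_y *\<^sub>R g) = f"
  "axis_y (end_x *\<^sub>R f - end_y *\<^sub>R g) (end_x *\<^sub>R f + end_y *\<^sub>R g) = g"
  using end_nonzero by (simp_all add: axis_x_def axis_y_def flip: scaleR_2)

text \<open>Scaled to length 1 and parametrized by arclength on [0, 1] when w and w' are unit
  vectors at the right angle. As a formula it makes sense for all w, w' and is linear in
  them.\<close>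

definition leaf :: "'a::euclidean_space \<Rightarrow> 'a \<Rightarrow> real \<Rightarrow> 'a" where
  "leaf w w' x = (1 / (2 * K_star)) *\<^sub>R
     (pos_x (2 * K_star * x - K_star) *\<^sub>R axis_x w w' + pos_y (2 * K_star * x - K_star) *\<^sub>R axis_y w w')"

definition leaf_tangent :: "'a::euclidean_space \<Rightarrow> 'a \<Rightarrow> real \<Rightarrow> 'a" where
  "leaf_tangent w w' x =
     tan_x (2 * K_star * x - K_star) *\<^sub>R axis_x w w' + tan_y (2 * K_star * x - K_star) *\<^sub>R axis_y w w'"

definition leaf_normal :: "'a::euclidean_space \<Rightarrow> 'a \<Rightarrow> real \<Rightarrow> 'a" where
  "leaf_normal w w' x =
     tan_x (2 * K_star * x - K_star) *\<^sub>R axis_y w w' - tan_y (2 * K_star * x - K_star) *\<^sub>R axis_x w w'"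

definition leaf_curvature :: "real \<Rightarrow> real" where
  "leaf_curvature x = 2 * K_star * curv (2 * K_star * x - K_star)"

lemma leaf_has_vector_derivative:
  "(leaf w w' has_vector_derivative leaf_tangent w w' x) (at x within S)"
  unfolding leaf_def leaf_tangent_def
  using K_star_pos
  by (auto intro!: derivative_eq_intros DERIV_chain2[OF pos_x_has_real_derivative]
      DERIV_chain2[OF pos_y_has_real_derivative] simp: scaleR_right_distrib)

lemma leaf_tangent_has_vector_derivative:
  "(leaf_tangent w w' has_vector_derivative leaf_curvature x *\<^sub>R leaf_normal w w' x) (at x within S)"
  unfolding leaf_tangent_def leaf_normal_def leaf_curvature_def
  by (auto intro!: derivative_eq_intros DERIV_chain2[OF tan_x_has_real_derivative]
      DERIV_chain2[OF tan_y_has_real_derivative] simp: algebra_simps)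

text \<open>The gluing conditions. Position and curvature vanish at both ends for all w and w', so
  consecutive leaves match to second order as soon as they share the tangent at the
  junction.\<close>

lemma leaf_ends:
  "leaf w w' 0 = 0" "leaf w w' 1 = 0" "leaf_tangent w w' 0 = w" "leaf_tangent w w' 1 = w'"
  "leaf_curvature 0 = 0" "leaf_curvature 1 = 0"
  by (simp_all add: leaf_def leaf_tangent_def leaf_curvature_def pos_K tan_K curv_K axes_tangents)

lemma norm_leaf_tangent:
  assumes "norm w = 1" "norm w' = 1" "w \<bullet> w' = cos (2 * phi_star)"
  shows "norm (leaf_tangent w w' x) = 1"
  using orthonormal_pair_axes[OF assms] tan_unit[of "2 * K_star * x - K_star"]
  by (simp add: orthonormal_pair_def leaf_tangent_def norm_eq_1 inner_simps power2_eq_square inner_commute)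

lemma rot90_leaf_tangent:
  assumes "norm w = 1" "norm w' = 1" "w \<bullet> w' = cos (2 * phi_star)"
  shows "rot90 (axis_x w w') (axis_y w w') (leaf_tangent w w' x) = leaf_normal w w' x"
  using orthonormal_pair_axes[OF assms]
  by (simp add: orthonormal_pair_def leaf_tangent_def leaf_normal_def rot90_def norm_eq_1 inner_simps inner_commute)

lemma leaf_linear:
  assumes "linear R"
  shows "R (leaf w w' x) = leaf (R w) (R w') x"
  by (simp add: leaf_def axis_x_def axis_y_def linear_cmul[OF assms] linear_add[OF assms] linear_diff[OF assms])

section \<open>Gluing along unit intervals, and congruence by reflections\<close>

lemma has_vector_derivative_chain_within:
  assumes "(s has_real_derivative s') (at x within S)"
    and "(g has_vector_derivative g') (at (s x) within T)" "s ` S \<subseteq> T"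
  shows "((\<lambda>x. g (s x)) has_vector_derivative s' *\<^sub>R g') (at x within S)"
  using vector_diff_chain_within[of s s' x S g g'] assms(1)
    has_vector_derivative_within_subset[OF assms(2,3)]
  by (simp add: has_real_derivative_iff_has_vector_derivative o_def)

definition glue :: "(int \<Rightarrow> real \<Rightarrow> 'a) \<Rightarrow> real \<Rightarrow> 'a" where
  "glue F x = F \<lfloor>x\<rfloor> (x - \<lfloor>x\<rfloor>)"

text \<open>At the right end the floor already selects the next piece; the matching condition makes
  both pieces agree there, so the formula holds on the closed interval.\<close>

lemma glue_eq:
  assumes "\<And>j. F j 1 = F (j + 1) 0" "x \<in> {of_int j..of_int j + 1}"
  shows "glue F x = F j (x - of_int j)"
proof (cases "x = of_int j + 1")
  case True
  then have "\<lfloor>x\<rfloor> = j + 1" by simp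
  then show ?thesis using assms(1)[of j] True by (simp add: glue_def)
next
  case False
  then have "\<lfloor>x\<rfloor> = j" using assms(2) by (intro floor_unique) auto
  then show ?thesis by (simp add: glue_def)
qed


text \<open>Reduces two-sided limits to limits within unit intervals. The ceiling minus 1 and the
  floor give the two neighbours of an integer, and the same interval twice at any other
  point.\<close>

lemma at_real_eq_sup_unit_intervals:
  obtains i j :: int where "x \<in> {of_int i..of_int i + 1}" "x \<in> {of_int j..of_int j + 1}"
    "at (x::real) = sup (at x within {of_int i..of_int i + 1}) (at x within {of_int j..of_int j + 1})"
proof -
  define i j where "i = \<lceil>x\<rceil> - 1" and "j = \<lfloor>x\<rfloor>"
  have *: "real_of_int i < x" "x \<le> of_int i + 1" "of_int j \<le> x" "x < of_int j + 1"
    unfolding i_def j_def by linarith+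
  have "x \<in> {real_of_int i<..<of_int j + 1}" using * by auto
  moreover have "{real_of_int i<..<of_int j + 1} \<subseteq> {of_int i..of_int i + 1} \<union> {of_int j..of_int j + 1}"
    using * by auto
  ultimately have "x \<in> interior ({real_of_int i..of_int i + 1} \<union> {of_int j..of_int j + 1})"
    by (meson interiorI open_greaterThanLessThan)
  then have "at x = sup (at x within {of_int i..of_int i + 1}) (at x within {of_int j..of_int j + 1})"
    by (metis at_within_interior at_within_union)
  with * show thesis by (intro that[of i j]) auto
qed

lemma has_vector_derivative_at_if_unit_intervals:
  assumes "\<And>j. x \<in> {of_int j..of_int j + 1} \<Longrightarrow>
    (f has_vector_derivative D) (at x within {of_int j..of_int j + 1})"
  shows "(f has_vector_derivative D) (at x)"
proof -
  obtain i j :: int where ij: "x \<in> {of_int i..of_int i + 1}" "x \<in> {of_int j..of_int j + 1}"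
    "at x = sup (at x within {of_int i..of_int i + 1}) (at x within {of_int j..of_int j + 1})"
    by (rule at_real_eq_sup_unit_intervals)
  show ?thesis
    using assms[OF ij(1)] assms[OF ij(2)] ij(3)
    unfolding has_vector_derivative_def has_derivative_at_within
    by (auto simp: filterlim_sup)
qed

lemma continuous_on_UNIV_if_unit_intervals:
  fixes f :: "real \<Rightarrow> 'a::topological_space"
  assumes "\<And>j. continuous_on {of_int j..of_int j + 1} f"
  shows "continuous_on UNIV f"
proof (rule continuous_at_imp_continuous_on, rule ballI)
  fix x :: real
  obtain i j :: int where ij: "x \<in> {of_int i..of_int i + 1}" "x \<in> {of_int j..of_int j + 1}"
    "at x = sup (at x within {of_int i..of_int i + 1}) (at x within {of_int j..of_int j + 1})"
    by (rule at_real_eq_sup_unit_intervals)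
  show "isCont f x"
    using assms[of i] assms[of j] ij unfolding isCont_def continuous_on_def by (auto simp: filterlim_sup)
qed

lemma glue_has_vector_derivative:
  assumes "\<And>j. F j 1 = F (j + 1) 0" "\<And>j. F' j 1 = F' (j + 1) 0"
    and "\<And>j x. x \<in> {0..1} \<Longrightarrow> (F j has_vector_derivative F' j x) (at x within {0..1})"
  shows "(glue F has_vector_derivative glue F' x) (at x)"
proof (rule has_vector_derivative_at_if_unit_intervals)
  fix j :: int assume x: "x \<in> {of_int j..of_int j + 1}"
  have "((\<lambda>x. F j (x - of_int j)) has_vector_derivative 1 *\<^sub>R F' j (x - of_int j))
      (at x within {of_int j..of_int j + 1})"
  proof (rule has_vector_derivative_chain_within)
    show "((\<lambda>x. x - of_int j) has_real_derivative 1) (at x within {of_int j..of_int j + 1})"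
      by (auto intro!: derivative_eq_intros)
    show "(F j has_vector_derivative F' j (x - of_int j)) (at (x - of_int j) within {0..1})"
      by (rule assms(3)) (use x in auto)
  qed auto
  then have "((\<lambda>x. F j (x - of_int j)) has_vector_derivative F' j (x - of_int j))
      (at x within {of_int j..of_int j + 1})"
    by simp
  then have "(glue F has_vector_derivative F' j (x - of_int j)) (at x within {of_int j..of_int j + 1})"
    by (rule has_vector_derivative_transform[rotated -1]) (use x glue_eq[of F, OF assms(1)] in auto)
  then show "(glue F has_vector_derivative glue F' x) (at x within {of_int j..of_int j + 1})"
    using glue_eq[of F', OF assms(2) x] by simp
qed

lemma continuous_on_glue:
  assumes "\<And>j. F j 1 = F (j + 1) 0" "\<And>j. continuous_on {0..1} (F j)"
  shows "continuous_on UNIV (glue F)"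
proof (rule continuous_on_UNIV_if_unit_intervals)
  fix j :: int
  have "continuous_on {of_int j..of_int j + 1} (\<lambda>x. F j (x - of_int j))"
    by (rule continuous_on_compose2[OF assms(2)]) (auto intro!: continuous_intros)
  then show "continuous_on {of_int j..of_int j + 1} (glue F)"
    by (rule continuous_on_eq) (use glue_eq[of F, OF assms(1)] in auto)
qed

lemma glue_add_int:
  assumes "\<And>j. F (j + k) = F j"
  shows "glue F (x + of_int k) = glue F x"
  using assms by (simp add: glue_def)

text \<open>Reflections replace the Gram--Schmidt process: the reflection exchanging two vectors of the
  same length fixes every vector that has the same inner product with both.\<close>

definition reflection :: "'a::euclidean_space \<Rightarrow> 'a \<Rightarrow> 'a \<Rightarrow> 'a" where
  "reflection a b x = x - (2 * (x \<bullet> (a - b)) / ((a - b) \<bullet> (a - b))) *\<^sub>R (a - b)"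

lemma linear_reflection: "linear (reflection a b)"
  by (rule linearI)
    (simp_all add: reflection_def inner_add_left distrib_left add_divide_distrib scaleR_add_left
      add_diff_add scaleR_diff_right mult.left_commute)

lemma reflection_inner: "reflection a b x \<bullet> reflection a b y = x \<bullet> y"
proof (cases "a = b")
  case False
  define d where "d = a - b"
  have "d \<bullet> d \<noteq> 0" using False by (simp add: d_def)
  then show ?thesis
    unfolding reflection_def d_def[symmetric]
    by (simp add: inner_diff_left inner_diff_right inner_commute field_simps)
qed (simp add: reflection_def)

lemma reflection_swap:
  assumes "norm a = norm b"
  shows "reflection a b a = b"
proof (cases "a = b")
  case False
  have "a \<bullet> a = b \<bullet> b" using assms by (simp add: norm_eq)
  then have "2 * (a \<bullet> (a - b)) = (a - b) \<bullet> (a - b)" by (simp add: inner_simps inner_commute)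
  then show ?thesis using False by (simp add: reflection_def)
qed (simp add: reflection_def)

lemma reflection_fix: "x \<bullet> a = x \<bullet> b \<Longrightarrow> reflection a b x = x"
  by (simp add: reflection_def inner_diff_right)

text \<open>Given R for the first n vectors, reflect \<open>R (v n)\<close> to \<open>w n\<close>.
  This fixes each earlier \<open>w i = R (v i)\<close>, whose inner products with
  \<open>R (v n)\<close> and \<open>w n\<close> both equal that of \<open>v i\<close> and
  \<open>v n\<close>. Linear dependence causes no case distinction.\<close>

lemma orthogonal_transformation_of_Gram:
  fixes v w :: "nat \<Rightarrow> 'a::euclidean_space"
  assumes "\<And>i j. i < n \<Longrightarrow> j < n \<Longrightarrow> v i \<bullet> v j = w i \<bullet> w j"
  shows "\<exists>R. orthogonal_transformation R \<and> (\<forall>i<n. R (v i) = w i)"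
  using assms
proof (induction n)
  case 0
  then show ?case using orthogonal_transformation_id by blast
next
  case (Suc n)
  then obtain R where R: "orthogonal_transformation R" "\<And>i. i < n \<Longrightarrow> R (v i) = w i"
    by (metis less_SucI)
  define R' where "R' = reflection (R (v n)) (w n) \<circ> R"
  have inner: "R x \<bullet> R y = x \<bullet> y" for x y
    using R(1) by (simp add: orthogonal_transformation_def)
  have "orthogonal_transformation R'"
    using R(1) unfolding R'_def
    by (intro orthogonal_transformation_compose)
      (auto simp: orthogonal_transformation_def linear_reflection reflection_inner)
  moreover have "R' (v n) = w n"
    using Suc.prems[of n n] inner[of "v n" "v n"] unfolding R'_def
    by (simp add: reflection_swap norm_eq)
  moreover have "R' (v i) = w i" if "i < n" for i
    using Suc.prems[of i n] inner[of "v i" "v n"] R(2)[OF that] that unfolding R'_def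
    by (simp add: reflection_fix)
  ultimately show ?case by (metis less_SucE)
qed

section \<open>Sobolev curves have no kinks\<close>

text \<open>Truncated powers from the square on are differentiable across 0; the derivatives of the
  bump, a truncated cube, rest on this.\<close>

lemma has_real_derivative_max_power:
  "((\<lambda>x::real. max 0 x ^ Suc (Suc n)) has_real_derivative real (Suc (Suc n)) * max 0 x ^ Suc n) (at x)"
proof (cases x "0::real" rule: linorder_cases)
  case less
  show ?thesis
    by (rule has_field_derivative_transform_within_open[of "\<lambda>_. 0" _ _ "{..<0}"])
      (use less in \<open>auto simp: max_def\<close>)
next
  case greater
  have "((\<lambda>x. x ^ Suc (Suc n)) has_real_derivative real (Suc (Suc n)) * x ^ Suc n) (at x)"
    using DERIV_pow[of "Suc (Suc n)" x] by simp
  then show ?thesis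
    by - (rule has_field_derivative_transform_within_open[of "\<lambda>x. x ^ Suc (Suc n)" _ _ "{0<..}"],
      use greater in \<open>auto simp: max_def\<close>)
next
  case equal
  have "((\<lambda>h::real. max 0 h ^ Suc n) \<longlongrightarrow> max 0 0 ^ Suc n) (at 0)"
    by (intro tendsto_intros)
  moreover have "(max 0 (0 + h) ^ Suc (Suc n) - max 0 0 ^ Suc (Suc n)) / h = max 0 h ^ Suc n" if "h \<noteq> 0" for h :: real
    using that by (auto simp: max_def)
  ultimately show ?thesis using equal
    unfolding DERIV_def by (subst tendsto_cong[of _ "\<lambda>h. max 0 h ^ Suc n"])
      (auto simp: eventually_at_filter)
qed

lemma LINT_lebesgue_on_eq_integral:
  fixes f :: "real \<Rightarrow> 'a::euclidean_space"
  assumes "continuous_on {a..b} f"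
  shows "integrable (lebesgue_on {a<..<b}) f"
    and "(LINT t|lebesgue_on {a<..<b}. f t) = integral {a..b} f"
proof -
  have "f absolutely_integrable_on {a<..<b}"
    using absolutely_integrable_continuous_real[OF assms]
    by (rule set_integrable_subset) auto
  then show *: "integrable (lebesgue_on {a<..<b}) f"
    by (simp add: integrable_restrict_space set_integrable_def)
  show "(LINT t|lebesgue_on {a<..<b}. f t) = integral {a..b} f"
    using lebesgue_integral_eq_integral[OF *] by (simp add: integral_open_interval_real)
qed

lemma L2_on_continuous:
  assumes "continuous_on {a..b} (u :: real \<Rightarrow> 'a::euclidean_space)"
  shows "L2_on a b u"
  unfolding L2_on_def
proof
  show "u \<in> borel_measurable (lebesgue_on {a<..<b})"
    using assms by (intro continuous_imp_measurable_on_sets_lebesgue)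
      (auto intro: continuous_on_subset)
  show "integrable (lebesgue_on {a<..<b}) (\<lambda>t. (norm (u t))\<^sup>2)"
    by (rule LINT_lebesgue_on_eq_integral) (intro continuous_intros assms)
qed

lemma L2_on_integrable:
  assumes "L2_on a b u"
  shows "integrable (lebesgue_on {a<..<b}) u"
proof (rule Bochner_Integration.integrable_bound)
  interpret finite_measure "lebesgue_on {a<..<b}"
    by (rule finite_measure_lebesgue_on) simp
  show "integrable (lebesgue_on {a<..<b}) (\<lambda>t. 1 + (norm (u t))\<^sup>2)"
    using assms by (auto simp: L2_on_def)
  have "x \<le> 1 + x\<^sup>2" for x :: real
    using zero_le_power2[of "x - 1/2"] by (simp add: power2_eq_square algebra_simps)
  then show "AE t in lebesgue_on {a<..<b}. norm (u t) \<le> norm (1 + (norm (u t))\<^sup>2)"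
    by (intro always_eventually allI) (metis abs_of_nonneg add_nonneg_nonneg real_norm_def zero_le_one zero_le_power2)
qed (use assms in \<open>auto simp: L2_on_def\<close>)

text \<open>Integration by parts; the boundary terms vanish because the support of the test function
  is compact in the open interval.\<close>

lemma weak_derivative_on_C1:
  fixes u :: "real \<Rightarrow> 'a::euclidean_space"
  assumes "a \<le> b" "\<And>t. t \<in> {a..b} \<Longrightarrow> (u has_vector_derivative v t) (at t within {a..b})"
    and v: "continuous_on {a..b} v"
  shows "weak_derivative_on a b u v"
  unfolding weak_derivative_on_def
proof (intro allI impI)
  fix \<psi> assume \<psi>: "test_function a b \<psi>"
  have d: "(\<psi> has_real_derivative deriv \<psi> t) (at t within S)" for t S
    using \<psi> by (auto simp: test_function_def field_differentiable_derivI has_field_derivative_at_within)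
  have c: "continuous_on {a..b} (deriv \<psi>)" "continuous_on {a..b} \<psi>" "continuous_on {a..b} u"
    using \<psi> continuous_on_vector_derivative[OF assms(2)]
    by (auto simp: test_function_def intro: continuous_on_subset DERIV_continuous_on d)
  have ends: "\<psi> a = 0" "\<psi> b = 0" using \<psi> by (force simp: test_function_def)+
  have "((\<lambda>t. \<psi> t *\<^sub>R v t + deriv \<psi> t *\<^sub>R u t) has_integral (\<psi> b *\<^sub>R u b - \<psi> a *\<^sub>R u a)) {a..b}"
    using assms(1,2) d by (intro fundamental_theorem_of_calculus has_vector_derivative_scaleR) auto
  then have "integral {a..b} (\<lambda>t. \<psi> t *\<^sub>R v t + deriv \<psi> t *\<^sub>R u t) = 0"
    by (simp add: ends integral_unique)
  then have "integral {a..b} (\<lambda>t. \<psi> t *\<^sub>R v t) + integral {a..b} (\<lambda>t. deriv \<psi> t *\<^sub>R u t) = 0"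
    by (subst (asm) integral_add) (intro integrable_continuous_real continuous_intros c v)+
  then show "(LINT t|lebesgue_on {a<..<b}. deriv \<psi> t *\<^sub>R u t) =
      - (LINT t|lebesgue_on {a<..<b}. \<psi> t *\<^sub>R v t)"
    by (subst (1 2) LINT_lebesgue_on_eq_integral) (auto intro!: continuous_intros c v simp: add_eq_0_iff)
qed

lemma H2_curve_C2:
  fixes u :: "real \<Rightarrow> 'a::euclidean_space"
  assumes "a \<le> b" "\<And>t. (u has_vector_derivative v t) (at t)" "\<And>t. (v has_vector_derivative w t) (at t)"
    and "continuous_on UNIV w"
  shows "H2_curve a b u"
proof -
  have c: "continuous_on {a..b} u" "continuous_on {a..b} v" "continuous_on {a..b} w"
    using assms(2-4) by (auto intro: continuous_on_subset has_vector_derivative_continuous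
        continuous_at_imp_continuous_on)
  moreover have "weak_derivative_on a b u v" "weak_derivative_on a b v w"
    by (rule weak_derivative_on_C1[OF assms(1) has_vector_derivative_at_within[OF assms(2)] c(2)])
      (rule weak_derivative_on_C1[OF assms(1) has_vector_derivative_at_within[OF assms(3)] c(3)])
  ultimately show ?thesis
    unfolding H2_curve_def W22_on_def by (blast intro: L2_on_continuous)
qed

text \<open>The kink of the curve at \<open>t\<^sub>0\<close> is detected by testing against the second derivative of a bump
  that shrinks to \<open>t\<^sub>0\<close>.\<close>

definition bump :: "real \<Rightarrow> real \<Rightarrow> real \<Rightarrow> real" where
  "bump t\<^sub>0 e t = max 0 (1 - ((t - t\<^sub>0) / e)\<^sup>2) ^ 3"

definition bump' :: "real \<Rightarrow> real \<Rightarrow> real \<Rightarrow> real" where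
  "bump' t\<^sub>0 e t = - 6 / e\<^sup>2 * (t - t\<^sub>0) * max 0 (1 - ((t - t\<^sub>0) / e)\<^sup>2) ^ 2"

definition bump'' :: "real \<Rightarrow> real \<Rightarrow> real \<Rightarrow> real" where
  "bump'' t\<^sub>0 e t = - 6 / e\<^sup>2 * max 0 (1 - ((t - t\<^sub>0) / e)\<^sup>2) ^ 2 +
     24 / e\<^sup>2 * ((t - t\<^sub>0) / e)\<^sup>2 * max 0 (1 - ((t - t\<^sub>0) / e)\<^sup>2)"

lemma radial_has_real_derivative:
  "((\<lambda>t. 1 - ((t - t\<^sub>0) / e)\<^sup>2) has_real_derivative - 2 / e\<^sup>2 * (t - t\<^sub>0)) (at t)"
proof (cases "e = 0")
  case False
  then show ?thesis
    by (auto intro!: derivative_eq_intros simp: power2_eq_square)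
qed simp

lemma bump_has_real_derivative: "(bump t\<^sub>0 e has_real_derivative bump' t\<^sub>0 e t) (at t)"
  unfolding bump_def bump'_def
  using DERIV_chain2[OF has_real_derivative_max_power[of 1] radial_has_real_derivative[of t\<^sub>0 e t]]
  by (simp add: numeral_eq_Suc algebra_simps)

lemma bump'_has_real_derivative: "(bump' t\<^sub>0 e has_real_derivative bump'' t\<^sub>0 e t) (at t)"
proof -
  define f where "f = max 0 (1 - ((t - t\<^sub>0) / e)\<^sup>2)"
  have "((\<lambda>t. t - t\<^sub>0) has_real_derivative 1) (at t)"
    by (auto intro!: derivative_eq_intros)
  from DERIV_cmult[OF this, of "- 6 / e\<^sup>2"]
  have "((\<lambda>t. - 6 / e\<^sup>2 * (t - t\<^sub>0)) has_real_derivative - 6 / e\<^sup>2) (at t)"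
    by simp
  note DERIV_mult[OF this DERIV_chain2[OF has_real_derivative_max_power[of 0] radial_has_real_derivative[of t\<^sub>0 e t]]]
  then have "(bump' t\<^sub>0 e has_real_derivative
      - 6 / e\<^sup>2 * f\<^sup>2 + (2 * f * (- 2 / e\<^sup>2 * (t - t\<^sub>0))) * (- 6 / e\<^sup>2 * (t - t\<^sub>0))) (at t)"
    unfolding bump'_def f_def numeral_2_eq_2 by simp
  moreover have "bump'' t\<^sub>0 e t =
      - 6 / e\<^sup>2 * f\<^sup>2 + (2 * f * (- 2 / e\<^sup>2 * (t - t\<^sub>0))) * (- 6 / e\<^sup>2 * (t - t\<^sub>0))"
    unfolding bump''_def f_def[symmetric]
    by (cases "e = 0") (simp_all add: power2_eq_square field_simps)
  ultimately show ?thesis by simp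
qed

lemma continuous_on_bump:
  "continuous_on S (bump t\<^sub>0 e)" "continuous_on S (bump' t\<^sub>0 e)" "continuous_on S (bump'' t\<^sub>0 e)"
  unfolding bump_def bump'_def bump''_def divide_inverse by (intro continuous_intros)+

lemma bump_outside:
  assumes "0 < e" "t \<notin> {t\<^sub>0 - e<..<t\<^sub>0 + e}"
  shows "bump t\<^sub>0 e t = 0" "bump' t\<^sub>0 e t = 0" "bump'' t\<^sub>0 e t = 0"
proof -
  have "1 \<le> \<bar>(t - t\<^sub>0) / e\<bar>" using assms by (auto simp: field_simps abs_if)
  then have "1 \<le> ((t - t\<^sub>0) / e)\<^sup>2" by (metis abs_le_square_iff abs_one one_power2)
  then have "max 0 (1 - ((t - t\<^sub>0) / e)\<^sup>2) = 0" by simp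
  then show "bump t\<^sub>0 e t = 0" "bump' t\<^sub>0 e t = 0" "bump'' t\<^sub>0 e t = 0"
    by (simp_all add: bump_def bump'_def bump''_def)
qed

lemma bump_bounds:
  assumes "0 < e"
  shows "0 \<le> bump t\<^sub>0 e t" "bump t\<^sub>0 e t \<le> 1" "\<bar>bump'' t\<^sub>0 e t\<bar> \<le> 30 / e\<^sup>2"
proof -
  define x where "x = ((t - t\<^sub>0) / e)\<^sup>2"
  define y where "y = max 0 (1 - x)"
  have y: "0 \<le> y" "y \<le> 1" by (auto simp: y_def x_def)
  then show "0 \<le> bump t\<^sub>0 e t" "bump t\<^sub>0 e t \<le> 1"
    by (auto simp: bump_def power_le_one simp flip: x_def y_def)
  have "y\<^sup>2 \<le> 1" using y by (simp add: power_le_one)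
  have "0 \<le> x" by (simp add: x_def)
  have "x * y \<le> 1"
  proof (cases "x \<le> 1")
    case True
    then show ?thesis using y \<open>0 \<le> x\<close> by (simp add: mult_le_one)
  next
    case False
    then show ?thesis by (simp add: y_def)
  qed
  have "bump'' t\<^sub>0 e t = (24 * (x * y) - 6 * y\<^sup>2) / e\<^sup>2"
    unfolding bump''_def x_def[symmetric] y_def[symmetric] by (simp add: diff_divide_distrib)
  \<comment> \<open>The 30 is 24 + 6, as \<open>x * y\<close> and \<open>y\<^sup>2\<close> lie in
    [0, 1].\<close>
  moreover have "\<bar>24 * (x * y) - 6 * y\<^sup>2\<bar> \<le> 30"
    using \<open>x * y \<le> 1\<close> \<open>y\<^sup>2 \<le> 1\<close> mult_nonneg_nonneg[OF \<open>0 \<le> x\<close> y(1)] zero_le_power2[of y] by linarith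
  ultimately show "\<bar>bump'' t\<^sub>0 e t\<bar> \<le> 30 / e\<^sup>2"
    by (simp add: divide_right_mono)
qed

lemma deriv_bump: "deriv (bump t\<^sub>0 e) = bump' t\<^sub>0 e" "deriv (bump' t\<^sub>0 e) = bump'' t\<^sub>0 e"
  by (rule ext, rule DERIV_imp_deriv, rule bump_has_real_derivative)
    (rule ext, rule DERIV_imp_deriv, rule bump'_has_real_derivative)

text \<open>Two weak derivatives mean two tests, one with the bump and one with its derivative. The
  exponent 3 in \<open>bump\<close> leaves \<open>bump'\<close> continuously differentiable.\<close>

lemma test_function_bump:
  assumes "0 < e" "a < t\<^sub>0 - e" "t\<^sub>0 + e < b"
  shows "test_function a b (bump t\<^sub>0 e)" "test_function a b (bump' t\<^sub>0 e)"
proof -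
  have "bump t\<^sub>0 e t = 0" "bump' t\<^sub>0 e t = 0" if "t \<notin> {t\<^sub>0 - e..t\<^sub>0 + e}" for t
    using bump_outside[OF assms(1), of t t\<^sub>0] that by auto
  then show "test_function a b (bump t\<^sub>0 e)" "test_function a b (bump' t\<^sub>0 e)"
    unfolding test_function_def deriv_bump field_differentiable_def
    using continuous_on_bump bump_has_real_derivative bump'_has_real_derivative assms(2,3) by blast+
qed

text \<open>Two integrations by parts move both derivatives onto an affine function;
  \<open>G\<close> is the resulting antiderivative and vanishes at both ends.\<close>

lemma bump''_integral_affine:
  fixes p d :: "'a::euclidean_space"
  assumes "0 < e"
  shows "((\<lambda>t. bump'' t\<^sub>0 e t *\<^sub>R (p + (t - t\<^sub>0) *\<^sub>R d)) has_integral 0) {t\<^sub>0 - e..t\<^sub>0 + e}"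
proof -
  define G where "G = (\<lambda>t. bump' t\<^sub>0 e t *\<^sub>R (p + (t - t\<^sub>0) *\<^sub>R d) - bump t\<^sub>0 e t *\<^sub>R d)"
  have "(G has_vector_derivative bump'' t\<^sub>0 e t *\<^sub>R (p + (t - t\<^sub>0) *\<^sub>R d)) (at t within S)" for t S
  proof -
    have "((\<lambda>t. p + (t - t\<^sub>0) *\<^sub>R d) has_vector_derivative d) (at t within S)"
      by (auto intro!: derivative_eq_intros)
    from has_vector_derivative_diff[OF
        has_vector_derivative_scaleR[OF has_field_derivative_at_within[OF bump'_has_real_derivative[of t\<^sub>0 e]] this]
        has_vector_derivative_scaleR[OF has_field_derivative_at_within[OF bump_has_real_derivative[of t\<^sub>0 e]]
          has_vector_derivative_const[of d]]]
    show ?thesis unfolding G_def by simp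
  qed
  then have "((\<lambda>t. bump'' t\<^sub>0 e t *\<^sub>R (p + (t - t\<^sub>0) *\<^sub>R d)) has_integral G (t\<^sub>0 + e) - G (t\<^sub>0 - e)) {t\<^sub>0 - e..t\<^sub>0 + e}"
    using assms by (intro fundamental_theorem_of_calculus) auto
  then show ?thesis using assms by (simp add: G_def bump_outside)
qed

text \<open>The second derivative of the hinge is the Dirac mass at \<open>t\<^sub>0\<close>, so the
  integral is the value 1 of the bump at its centre.\<close>

lemma bump''_integral_hinge:
  assumes "0 < e"
  shows "((\<lambda>t. bump'' t\<^sub>0 e t * max 0 (t - t\<^sub>0)) has_integral 1) {t\<^sub>0 - e..t\<^sub>0 + e}"
proof -
  define G where "G = (\<lambda>t. bump' t\<^sub>0 e t * (t - t\<^sub>0) - bump t\<^sub>0 e t)"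
  have "(G has_real_derivative bump'' t\<^sub>0 e t * (t - t\<^sub>0)) (at t)" for t
  proof -
    have "((\<lambda>t. t - t\<^sub>0) has_real_derivative 1) (at t)"
      by (auto intro!: derivative_eq_intros)
    from DERIV_diff[OF DERIV_mult[OF bump'_has_real_derivative[of t\<^sub>0 e] this] bump_has_real_derivative[of t\<^sub>0 e]]
    show ?thesis unfolding G_def by simp
  qed
  then have "((\<lambda>t. bump'' t\<^sub>0 e t * (t - t\<^sub>0)) has_integral G (t\<^sub>0 + e) - G t\<^sub>0) {t\<^sub>0..t\<^sub>0 + e}"
    using assms by (intro fundamental_theorem_of_calculus)
      (auto simp: has_real_derivative_iff_has_vector_derivative[symmetric] has_field_derivative_at_within)
  also have "G (t\<^sub>0 + e) - G t\<^sub>0 = 1"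
    using assms by (simp add: G_def bump_outside) (simp add: bump_def)
  finally have "((\<lambda>t. bump'' t\<^sub>0 e t * max 0 (t - t\<^sub>0)) has_integral 1) {t\<^sub>0..t\<^sub>0 + e}"
    by (rule has_integral_eq[rotated]) auto
  moreover have "((\<lambda>t. bump'' t\<^sub>0 e t * max 0 (t - t\<^sub>0)) has_integral 0) {t\<^sub>0 - e..t\<^sub>0}"
    by (rule has_integral_is_0) auto
  ultimately have "((\<lambda>t. bump'' t\<^sub>0 e t * max 0 (t - t\<^sub>0)) has_integral 0 + 1) {t\<^sub>0 - e..t\<^sub>0 + e}"
    using assms by (intro has_integral_combine[of "t\<^sub>0 - e" t\<^sub>0 "t\<^sub>0 + e"]) auto
  then show ?thesis by simp
qed

lemma LINT_eq_has_integral_support: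
  fixes f :: "real \<Rightarrow> 'a::euclidean_space"
  assumes "continuous_on {a..b} f" "(f has_integral I) {c..d}" "{c..d} \<subseteq> {a..b}"
    and "\<And>t. t \<notin> {c..d} \<Longrightarrow> f t = 0"
  shows "(LINT t|lebesgue_on {a<..<b}. f t) = I"
proof -
  have "(f has_integral I) {a..b}"
    by (rule has_integral_on_superset[OF assms(2) _ assms(3)]) (use assms(4) in blast)
  then show ?thesis
    unfolding LINT_lebesgue_on_eq_integral(2)[OF assms(1)] by (rule integral_unique)
qed

text \<open>Near a corner the curve is an affine function plus a hinge times the jump of the
  derivative, up to an error o(e) uniform on the window of radius e.\<close>

lemma hinge_remainder:
  fixes \<gamma> :: "real \<Rightarrow> 'a::euclidean_space"
  assumes "(\<gamma> has_vector_derivative D\<^sub>1) (at t\<^sub>0 within {a..t\<^sub>0})"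
    and "(\<gamma> has_vector_derivative D\<^sub>2) (at t\<^sub>0 within {t\<^sub>0..b})" "0 < \<delta>" "a < t\<^sub>0" "t\<^sub>0 < b"
  shows "\<forall>\<^sub>F e in at_right 0. \<forall>t\<in>{t\<^sub>0 - e..t\<^sub>0 + e}.
    norm (\<gamma> t - (\<gamma> t\<^sub>0 + (t - t\<^sub>0) *\<^sub>R D\<^sub>1) - max 0 (t - t\<^sub>0) *\<^sub>R (D\<^sub>2 - D\<^sub>1)) \<le> \<delta> * e"
proof -
  obtain r\<^sub>1 where r1: "0 < r\<^sub>1" "\<And>t. t \<in> {a..t\<^sub>0} \<Longrightarrow> norm (t - t\<^sub>0) < r\<^sub>1 \<Longrightarrow>
      norm (\<gamma> t - \<gamma> t\<^sub>0 - (t - t\<^sub>0) *\<^sub>R D\<^sub>1) \<le> \<delta> * norm (t - t\<^sub>0)"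
    using assms(1,3) unfolding has_vector_derivative_def has_derivative_within_alt by blast
  obtain r\<^sub>2 where r2: "0 < r\<^sub>2" "\<And>t. t \<in> {t\<^sub>0..b} \<Longrightarrow> norm (t - t\<^sub>0) < r\<^sub>2 \<Longrightarrow>
      norm (\<gamma> t - \<gamma> t\<^sub>0 - (t - t\<^sub>0) *\<^sub>R D\<^sub>2) \<le> \<delta> * norm (t - t\<^sub>0)"
    using assms(2,3) unfolding has_vector_derivative_def has_derivative_within_alt by blast
  define r where "r = min (min r\<^sub>1 r\<^sub>2) (min (t\<^sub>0 - a) (b - t\<^sub>0))"
  have "0 < r" using r1(1) r2(1) assms by (simp add: r_def)
  moreover have "norm (\<gamma> t - (\<gamma> t\<^sub>0 + (t - t\<^sub>0) *\<^sub>R D\<^sub>1) - max 0 (t - t\<^sub>0) *\<^sub>R (D\<^sub>2 - D\<^sub>1)) \<le> \<delta> * e"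
    if e: "e < r" "t \<in> {t\<^sub>0 - e..t\<^sub>0 + e}" for t e
  proof -
    have "\<delta> * norm (t - t\<^sub>0) \<le> \<delta> * e" using e \<open>0 < \<delta>\<close> by (intro mult_left_mono) auto
    then show ?thesis
      using r1(2)[of t] r2(2)[of t] e unfolding r_def
      by (cases "t \<le> t\<^sub>0") (auto simp: max_def algebra_simps)
  qed
  ultimately show ?thesis
    unfolding eventually_at_right_field by blast
qed

text \<open>Tested against \<open>bump''\<close>, the affine part contributes 0, the hinge part the
  full jump, and the remainder at most 60 \<delta>. By weak differentiation the same integral equals
  that of the bump times w, which tends to 0 because the support shrinks to a point.\<close>

lemma W22_on_no_kink:
  fixes \<gamma> :: "real \<Rightarrow> 'a::euclidean_space"
  assumes "W22_on a b \<gamma>" and cont: "continuous_on {a..b} \<gamma>" and t0: "a < t\<^sub>0" "t\<^sub>0 < b"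
    and D1: "(\<gamma> has_vector_derivative D\<^sub>1) (at t\<^sub>0 within {a..t\<^sub>0})"
    and D2: "(\<gamma> has_vector_derivative D\<^sub>2) (at t\<^sub>0 within {t\<^sub>0..b})"
  shows "D\<^sub>1 = D\<^sub>2"
proof -
  obtain v w where w: "L2_on a b w" and weak: "weak_derivative_on a b \<gamma> v" "weak_derivative_on a b v w"
    using assms(1) unfolding W22_on_def by blast
  define \<Phi> where "\<Phi> = (\<lambda>e. LINT t|lebesgue_on {a<..<b}. bump t\<^sub>0 e t *\<^sub>R w t)"
  define r where "r = min (t\<^sub>0 - a) (b - t\<^sub>0)"
  have "0 < r" using t0 by (simp add: r_def)
  define \<epsilon> where "\<epsilon> = (\<lambda>n. r * inverse (real (Suc n)))"
  have \<epsilon>: "0 < \<epsilon> n" for n using \<open>0 < r\<close> by (simp add: \<epsilon>_def)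
  have \<epsilon>_lim: "\<epsilon> \<longlonglongrightarrow> 0"
    unfolding \<epsilon>_def by (intro tendsto_mult_right_zero LIMSEQ_inverse_real_of_nat)
  \<comment> \<open>The signs of the two weak differentiations cancel.\<close>
  have second: "(LINT t|lebesgue_on {a<..<b}. bump'' t\<^sub>0 e t *\<^sub>R \<gamma> t) = \<Phi> e" if "0 < e" "e < r" for e
    using weak test_function_bump[of e a t\<^sub>0 b] that unfolding weak_derivative_on_def \<Phi>_def r_def
    by (force simp: deriv_bump)
  have lim: "(\<lambda>n. \<Phi> (\<epsilon> n)) \<longlonglongrightarrow> (LINT t|lebesgue_on {a<..<b}. 0)"
    unfolding \<Phi>_def
  proof (rule integral_dominated_convergence)
    have wm: "w \<in> borel_measurable (lebesgue_on {a<..<b})" using w by (simp add: L2_on_def)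
    show "(\<lambda>t. bump t\<^sub>0 (\<epsilon> n) t *\<^sub>R w t) \<in> borel_measurable (lebesgue_on {a<..<b})" for n
      by (intro borel_measurable_scaleR wm continuous_imp_measurable_on_sets_lebesgue continuous_on_bump) auto
    show "integrable (lebesgue_on {a<..<b}) (\<lambda>t. norm (w t))"
      using L2_on_integrable[OF w] by (rule integrable_norm)
    show "AE t in lebesgue_on {a<..<b}. norm (bump t\<^sub>0 (\<epsilon> n) t *\<^sub>R w t) \<le> norm (w t)" for n
      using bump_bounds[OF \<epsilon>] by (auto simp: mult_left_le_one_le)
    \<comment> \<open>At the centre every bump equals 1, so pointwise convergence to 0 holds only
      off this null set.\<close>
    have "AE t in lebesgue. t \<noteq> t\<^sub>0"
      by (intro AE_I'[of "{t\<^sub>0}"]) auto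
    moreover have "(\<lambda>n. bump t\<^sub>0 (\<epsilon> n) t *\<^sub>R w t) \<longlonglongrightarrow> 0" if "t \<noteq> t\<^sub>0" for t
    proof (rule tendsto_eventually)
      have "\<forall>\<^sub>F n in sequentially. \<epsilon> n < \<bar>t - t\<^sub>0\<bar>"
        by (rule order_tendstoD(2)[OF \<epsilon>_lim]) (use that in auto)
      then show "\<forall>\<^sub>F n in sequentially. bump t\<^sub>0 (\<epsilon> n) t *\<^sub>R w t = 0"
        by eventually_elim (subst bump_outside, use \<epsilon> in auto)
    qed
    ultimately show "AE t in lebesgue_on {a<..<b}. (\<lambda>n. bump t\<^sub>0 (\<epsilon> n) t *\<^sub>R w t) \<longlonglongrightarrow> 0"
      by (subst AE_restrict_space_iff) auto
  qed auto
  have "norm (D\<^sub>2 - D\<^sub>1) \<le> 60 * \<delta>" if "0 < \<delta>" for \<delta>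
  proof -
    have "\<forall>\<^sub>F e in at_right 0. e < r" using \<open>0 < r\<close> eventually_at_right_field by blast
    with hinge_remainder[OF D1 D2 \<open>0 < \<delta>\<close> t0] eventually_at_right_less[of 0]
    have "\<forall>\<^sub>F e in at_right 0. norm (D\<^sub>2 - D\<^sub>1) \<le> norm (\<Phi> e) + 60 * \<delta>"
    proof eventually_elim
      case (elim e)
      define R where "R = (\<lambda>t. \<gamma> t - (\<gamma> t\<^sub>0 + (t - t\<^sub>0) *\<^sub>R D\<^sub>1) - max 0 (t - t\<^sub>0) *\<^sub>R (D\<^sub>2 - D\<^sub>1))"
      have sub: "{t\<^sub>0 - e..t\<^sub>0 + e} \<subseteq> {a..b}" using elim by (auto simp: r_def)
      have "continuous_on {t\<^sub>0 - e..t\<^sub>0 + e} (\<lambda>t. bump'' t\<^sub>0 e t *\<^sub>R R t)"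
        unfolding R_def by (intro continuous_intros continuous_on_bump continuous_on_subset[OF cont sub])
      then obtain I where I: "((\<lambda>t. bump'' t\<^sub>0 e t *\<^sub>R R t) has_integral I) {t\<^sub>0 - e..t\<^sub>0 + e}"
        using integrable_continuous_real by blast
      \<comment> \<open>The window has length 2e, so the powers of e cancel and 60 \<delta>
        remains.\<close>
      have "norm I \<le> (30 / e\<^sup>2 * (\<delta> * e)) * measure lborel (cbox (t\<^sub>0 - e) (t\<^sub>0 + e))"
      proof (rule has_integral_bound)
        show "norm (bump'' t\<^sub>0 e t *\<^sub>R R t) \<le> 30 / e\<^sup>2 * (\<delta> * e)" if "t \<in> cbox (t\<^sub>0 - e) (t\<^sub>0 + e)" for t
        proof -
          have "norm (R t) \<le> \<delta> * e" using elim that by (simp add: R_def)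
          then show ?thesis
            unfolding norm_scaleR real_norm_def using bump_bounds(3)[OF \<open>0 < e\<close>]
            by (intro mult_mono) auto
        qed
      qed (use I elim \<open>0 < \<delta>\<close> in auto)
      also have "\<dots> = 60 * \<delta>" using elim by (simp add: field_simps power2_eq_square)
      finally have "norm I \<le> 60 * \<delta>" .
      have "((\<lambda>t. bump'' t\<^sub>0 e t *\<^sub>R (\<gamma> t\<^sub>0 + (t - t\<^sub>0) *\<^sub>R D\<^sub>1) + (bump'' t\<^sub>0 e t * max 0 (t - t\<^sub>0)) *\<^sub>R (D\<^sub>2 - D\<^sub>1)
          + bump'' t\<^sub>0 e t *\<^sub>R R t) has_integral (0 + 1 *\<^sub>R (D\<^sub>2 - D\<^sub>1) + I)) {t\<^sub>0 - e..t\<^sub>0 + e}"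
        using elim by (intro has_integral_add has_integral_scaleR_left bump''_integral_affine bump''_integral_hinge I)
      moreover have "(\<lambda>t. bump'' t\<^sub>0 e t *\<^sub>R (\<gamma> t\<^sub>0 + (t - t\<^sub>0) *\<^sub>R D\<^sub>1) + (bump'' t\<^sub>0 e t * max 0 (t - t\<^sub>0)) *\<^sub>R (D\<^sub>2 - D\<^sub>1)
          + bump'' t\<^sub>0 e t *\<^sub>R R t) = (\<lambda>t. bump'' t\<^sub>0 e t *\<^sub>R \<gamma> t)"
        by (simp add: R_def fun_eq_iff scaleR_diff_right)
      ultimately have "((\<lambda>t. bump'' t\<^sub>0 e t *\<^sub>R \<gamma> t) has_integral (D\<^sub>2 - D\<^sub>1 + I)) {t\<^sub>0 - e..t\<^sub>0 + e}"
        by simp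
      then have "\<Phi> e = D\<^sub>2 - D\<^sub>1 + I"
        using elim sub bump_outside(3)[of e]
        by (subst second[symmetric])
          (auto intro!: LINT_eq_has_integral_support continuous_intros continuous_on_bump cont)
      then have "D\<^sub>2 - D\<^sub>1 = \<Phi> e - I" by simp
      then show ?case using \<open>norm I \<le> 60 * \<delta>\<close> norm_triangle_ineq4[of "\<Phi> e" I] by simp
    qed
    moreover have "filterlim \<epsilon> (at_right 0) sequentially"
      using \<epsilon>_lim \<epsilon> by (intro tendsto_imp_filterlim_at_right) auto
    ultimately have "\<forall>\<^sub>F n in sequentially. norm (D\<^sub>2 - D\<^sub>1) \<le> norm (\<Phi> (\<epsilon> n)) + 60 * \<delta>"
      by (rule eventually_compose_filterlim)
    moreover have "(\<lambda>n. norm (\<Phi> (\<epsilon> n)) + 60 * \<delta>) \<longlonglongrightarrow> norm (0::'a) + 60 * \<delta>"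
      using lim by (intro tendsto_intros) simp
    ultimately have "norm (D\<^sub>2 - D\<^sub>1) \<le> norm (0::'a) + 60 * \<delta>"
      by (intro tendsto_lowerbound[of _ _ sequentially]) auto
    then show ?thesis by simp
  qed
  \<comment> \<open>With this \<delta> the jump is at most half of itself.\<close>
  from this[of "norm (D\<^sub>2 - D\<^sub>1) / 120"] show ?thesis
    by (cases "D\<^sub>2 = D\<^sub>1") auto
qed

section \<open>Closed immersed curves and isometric images\<close>

lemma periodic_of_int:
  fixes f :: "real \<Rightarrow> 'a"
  assumes "\<And>t. f (t + 1) = f t"
  shows "f (t + of_int k) = f t"
proof (induction k rule: int_induct[of _ 0])
  case (step1 k)
  then show ?case using assms[of "t + of_int k"] by (simp add: add.assoc)
next
  case (step2 k)
  then show ?case using assms[of "t + of_int (k - 1)"] by (simp add: add.assoc)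
qed simp

lemma has_vector_derivative_shift_within:
  assumes "(g has_vector_derivative g') (at (x + d) within T)" "\<And>y. y \<in> S \<Longrightarrow> y + d \<in> T"
  shows "((\<lambda>y. g (y + d)) has_vector_derivative g') (at x within S)"
proof -
  have "((\<lambda>y. y + d) has_real_derivative 1) (at x within S)"
    by (auto intro!: derivative_eq_intros)
  from has_vector_derivative_chain_within[OF this assms(1)] show ?thesis
    using assms(2) by auto
qed

text \<open>Periodic copies of the derivative on [0, 1] can fail to fit only at the seam
  \<open>t\<^sub>0\<close>. There the end value is the left derivative and the initial value the
  right derivative of one Sobolev curve, so they agree.\<close>

lemma closed_H2_curve_immersed_C1:
  fixes \<gamma> :: "real \<Rightarrow> 'a::euclidean_space"
  assumes H2: "closed_H2_curve \<gamma>" and imm: "immersed_curve 0 1 (\<lambda>t. \<gamma> (t + t\<^sub>0))"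
  obtains D where "continuous_on UNIV D" "\<And>t. (\<gamma> has_vector_derivative D t) (at t)"
    "\<And>t. D t \<noteq> 0" "\<And>t. D (t + 1) = D t"
proof -
  define g where "g = (\<lambda>t. \<gamma> (t + t\<^sub>0))"
  have per: "\<gamma> (t + 1) = \<gamma> t" for t using H2 by (simp add: closed_H2_curve_def)
  obtain D\<^sub>0 where D0: "continuous_on {0..1} D\<^sub>0" "\<And>t. t \<in> {0..1} \<Longrightarrow> (g has_vector_derivative D\<^sub>0 t) (at t within {0..1})"
    "\<And>t. t \<in> {0..1} \<Longrightarrow> D\<^sub>0 t \<noteq> 0"
    using imm unfolding immersed_curve_def g_def by blast
  have "D\<^sub>0 1 = D\<^sub>0 0"
  proof (rule W22_on_no_kink)
    show "W22_on (t\<^sub>0 - 1) (t\<^sub>0 + 1) \<gamma>" "continuous_on {t\<^sub>0 - 1..t\<^sub>0 + 1} \<gamma>"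
      using H2 by (auto simp: closed_H2_curve_def H2_curve_def)
    have "((\<lambda>t. g (t + (1 - t\<^sub>0))) has_vector_derivative D\<^sub>0 1) (at t\<^sub>0 within {t\<^sub>0 - 1..t\<^sub>0})"
      by (rule has_vector_derivative_shift_within[where T = "{0..1}"]) (auto intro: D0(2))
    moreover have "(\<lambda>t. g (t + (1 - t\<^sub>0))) = \<gamma>" using per by (simp add: g_def fun_eq_iff)
    ultimately show "(\<gamma> has_vector_derivative D\<^sub>0 1) (at t\<^sub>0 within {t\<^sub>0 - 1..t\<^sub>0})" by simp
    have "((\<lambda>t. g (t + (- t\<^sub>0))) has_vector_derivative D\<^sub>0 0) (at t\<^sub>0 within {t\<^sub>0..t\<^sub>0 + 1})"
      by (rule has_vector_derivative_shift_within[where T = "{0..1}"]) (auto intro: D0(2))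
    then show "(\<gamma> has_vector_derivative D\<^sub>0 0) (at t\<^sub>0 within {t\<^sub>0..t\<^sub>0 + 1})" by (simp add: g_def)
  qed auto
  have "g (t + 1) = g t" for t using per[of "t + t\<^sub>0"] by (simp add: g_def ac_simps)
  then have "glue (\<lambda>_. g) = g"
  proof (intro ext)
    show "glue (\<lambda>_. g) x = g x" for x
      using periodic_of_int[of g x "- \<lfloor>x\<rfloor>"] \<open>\<And>t. g (t + 1) = g t\<close> by (simp add: glue_def)
  qed
  define G where "G = glue (\<lambda>_::int. D\<^sub>0)"
  have "(g has_vector_derivative G x) (at x)" for x
    using glue_has_vector_derivative[of "\<lambda>_. g" "\<lambda>_. D\<^sub>0" x] D0(2) \<open>D\<^sub>0 1 = D\<^sub>0 0\<close> per[of t\<^sub>0] \<open>glue (\<lambda>_. g) = g\<close>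
    by (simp add: G_def) (simp add: g_def add.commute)
  then have deriv: "(\<gamma> has_vector_derivative G (t + (- t\<^sub>0))) (at t)" for t
    using has_vector_derivative_shift_within[of g "G (t + (- t\<^sub>0))" t "- t\<^sub>0" UNIV UNIV]
    by (simp add: g_def)
  have "continuous_on UNIV G"
    unfolding G_def by (rule continuous_on_glue) (use D0 \<open>D\<^sub>0 1 = D\<^sub>0 0\<close> in auto)
  then have "continuous_on UNIV (\<lambda>t. G (t + (- t\<^sub>0)))"
    by (rule continuous_on_compose2) (auto intro!: continuous_intros)
  moreover have "G t \<noteq> 0" for t
    unfolding G_def glue_def by (rule D0(3)) (auto, linarith)
  moreover have "G (t + 1 + (- t\<^sub>0)) = G (t + (- t\<^sub>0))" for t
    using glue_add_int[of "\<lambda>_. D\<^sub>0" 1 "t + (- t\<^sub>0)"] by (simp add: G_def algebra_simps)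
  ultimately show thesis using deriv by (intro that[of "\<lambda>t. G (t + (- t\<^sub>0))"]) auto
qed

lemma arclength_eq:
  assumes "a < b" "\<And>t. t \<in> {a..b} \<Longrightarrow> (\<gamma> has_vector_derivative D t) (at t within {a..b})"
    and "\<And>t. t \<in> {a..b} \<Longrightarrow> (S has_real_derivative norm (D t)) (at t within {a..b})" "t \<in> {a..b}"
  shows "arclength a b \<gamma> t = S t - S a"
proof -
  have "(S has_real_derivative norm (D u)) (at u within {a..t})" if "u \<in> {a..t}" for u
    by (rule DERIV_subset[OF assms(3)]) (use that assms(4) in auto)
  then have "((\<lambda>u. norm (D u)) has_integral (S t - S a)) {a..t}"
    using assms(4) by (intro fundamental_theorem_of_calculus)
      (auto simp flip: has_real_derivative_iff_has_vector_derivative)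
  moreover have "norm (vector_derivative \<gamma> (at u within {a..b})) = norm (D u)" if "u \<in> {a..t}" for u
    using vector_derivative_within_closed_interval[OF \<open>a < b\<close> _ assms(2)] that assms(4) by auto
  ultimately show ?thesis
    unfolding arclength_def by (subst integral_cong) (auto simp: integral_unique)
qed

section \<open>Invariance of all notions under linear isometric embeddings\<close>

lemma isometry_inner:
  assumes "linear J" "\<And>x. norm (J x) = norm x"
  shows "J x \<bullet> J y = x \<bullet> y"
  using assms by (simp add: dot_norm flip: linear_add)

lemma has_vector_derivative_linear:
  fixes J :: "'a::euclidean_space \<Rightarrow> 'b::euclidean_space"
  assumes "linear J" "(f has_vector_derivative f') F"
  shows "((\<lambda>t. J (f t)) has_vector_derivative J f') F"
  using bounded_linear.has_vector_derivative[OF _ assms(2)] assms(1)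
  by (simp add: linear_conv_bounded_linear)

lemma H2_curve_isometry:
  fixes J :: "'a::euclidean_space \<Rightarrow> 'b::euclidean_space"
  assumes J: "linear J" "\<And>x. norm (J x) = norm x" and "H2_curve a b u"
  shows "H2_curve a b (\<lambda>t. J (u t))"
proof -
  have bl: "bounded_linear J" "bounded_linear (adjoint J)"
    using J(1) by (auto simp flip: linear_conv_bounded_linear intro: adjoint_linear)
  \<comment> \<open>With this linear left inverse, J commutes with the Bochner integral even where
    the integrand is not integrable and the integral takes its default value.\<close>
  have "adjoint J (J x) = x" for x
    by (subst vector_eq_rdot[symmetric]) (simp add: adjoint_clauses[OF J(1)] isometry_inner[OF J])
  then have LINT: "(LINT t|M. J (f t)) = J (LINT t|M. f t)" for f and M :: "real measure"
    using integral_bounded_linear'[OF bl] by blast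
  have L2: "L2_on a b (\<lambda>t. J (v t))" if "L2_on a b v" for v
    using that unfolding L2_on_def J(2)
    by (intro conjI borel_measurable_continuous_on[OF linear_continuous_on[OF bl(1)]]) auto
  have weak: "weak_derivative_on a b (\<lambda>t. J (v t)) (\<lambda>t. J (w t))" if "weak_derivative_on a b v w" for v w
    using that by (simp add: weak_derivative_on_def LINT linear_neg[OF J(1)] flip: linear_cmul[OF J(1)])
  obtain v w where "L2_on a b v" "L2_on a b w" "weak_derivative_on a b u v" "weak_derivative_on a b v w"
      "L2_on a b u" "continuous_on {a..b} u"
    using assms(3) unfolding H2_curve_def W22_on_def by blast
  then show ?thesis
    unfolding H2_curve_def W22_on_def
    by (blast intro: L2 weak continuous_on_compose2[OF linear_continuous_on[OF bl(1), of UNIV]])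
qed

lemma immersed_curve_isometry:
  fixes J :: "'a::euclidean_space \<Rightarrow> 'b::euclidean_space"
  assumes J: "linear J" "\<And>x. norm (J x) = norm x" and "immersed_curve a b \<gamma>"
  shows "immersed_curve a b (\<lambda>t. J (\<gamma> t))"
proof -
  obtain D where D: "continuous_on {a..b} D"
      "\<And>t. t \<in> {a..b} \<Longrightarrow> (\<gamma> has_vector_derivative D t) (at t within {a..b}) \<and> D t \<noteq> 0"
    using assms(3) unfolding immersed_curve_def by blast
  have "J x \<noteq> 0" if "x \<noteq> 0" for x using J(2)[of x] that by auto
  moreover have "continuous_on {a..b} (\<lambda>t. J (D t))"
    by (rule continuous_on_compose2[OF linear_continuous_on D(1), of J UNIV])
      (use J(1) in \<open>auto simp: linear_conv_bounded_linear\<close>)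
  ultimately show ?thesis
    using D(2) has_vector_derivative_linear[OF J(1)] unfolding immersed_curve_def by blast
qed

lemma arclength_isometry:
  fixes J :: "'a::euclidean_space \<Rightarrow> 'b::euclidean_space"
  assumes J: "linear J" "\<And>x. norm (J x) = norm x" and "immersed_curve a b \<gamma>" "a < b" "t \<le> b"
  shows "arclength a b (\<lambda>t. J (\<gamma> t)) t = arclength a b \<gamma> t"
  unfolding arclength_def
proof (rule integral_cong)
  fix u assume u: "u \<in> {a..t}"
  obtain D where "\<And>t. t \<in> {a..b} \<Longrightarrow> (\<gamma> has_vector_derivative D t) (at t within {a..b})"
    using assms(3) unfolding immersed_curve_def by blast
  then have D: "(\<gamma> has_vector_derivative D u) (at u within {a..b})" and "u \<in> {a..b}"
    using u assms(5) by auto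
  then show "norm (vector_derivative (\<lambda>t. J (\<gamma> t)) (at u within {a..b})) =
      norm (vector_derivative \<gamma> (at u within {a..b}))"
    using vector_derivative_within_closed_interval[OF \<open>a < b\<close>] has_vector_derivative_linear[OF J(1) D] J(2)
    by metis
qed

lemma half_fold_figure_eight_isometry:
  fixes J :: "'a::euclidean_space \<Rightarrow> 'b::euclidean_space"
  assumes J: "linear J" "\<And>x. norm (J x) = norm x" and "half_fold_figure_eight a b \<gamma>"
  shows "half_fold_figure_eight a b (\<lambda>t. J (\<gamma> t))"
proof -
  note inner = isometry_inner[OF J]
  obtain p e\<^sub>1 e\<^sub>2 \<sigma> where ab: "a < b" "immersed_curve a b \<gamma>"
    and e: "orthonormal_pair e\<^sub>1 e\<^sub>2" "\<gamma> ` {a..b} \<subseteq> affine_plane p e\<^sub>1 e\<^sub>2"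
    and \<sigma>: "\<forall>t\<in>{a..b}. \<gamma> t = \<sigma> (arclength a b \<gamma> t)"
    and curv: "has_signed_curvature e\<^sub>1 e\<^sub>2 (curve_length a b \<gamma>) \<sigma>
      (\<lambda>s. 2 * sqrt m_star * (2 * ellK m_star / curve_length a b \<gamma>) *
        jacobi_cn ((2 * ellK m_star / curve_length a b \<gamma>) * s - ellK m_star) m_star)"
    using assms(3) unfolding half_fold_figure_eight_def Let_def by blast
  have len: "arclength a b (\<lambda>t. J (\<gamma> t)) t = arclength a b \<gamma> t" if "t \<le> b" for t
    using arclength_isometry[OF J ab(2,1)] that by blast
  have rot: "rot90 (J e\<^sub>1) (J e\<^sub>2) (J x) = J (rot90 e\<^sub>1 e\<^sub>2 x)" for x
    by (simp add: rot90_def inner linear_diff[OF J(1)] linear_cmul[OF J(1)])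
  have "has_signed_curvature (J e\<^sub>1) (J e\<^sub>2) L (\<lambda>s. J (\<sigma> s)) k" if h: "has_signed_curvature e\<^sub>1 e\<^sub>2 L \<sigma> k" for L k
  proof -
    obtain T where T: "\<And>s. s \<in> {0..L} \<Longrightarrow> (\<sigma> has_vector_derivative T s) (at s within {0..L}) \<and> norm (T s) = 1 \<and>
        (T has_vector_derivative k s *\<^sub>R rot90 e\<^sub>1 e\<^sub>2 (T s)) (at s within {0..L})"
      using h unfolding has_signed_curvature_def by blast
    show ?thesis
      unfolding has_signed_curvature_def
    proof (intro exI ballI conjI)
      fix s assume s: "s \<in> {0..L}"
      show "((\<lambda>s. J (\<sigma> s)) has_vector_derivative J (T s)) (at s within {0..L})"
        using T[OF s] has_vector_derivative_linear[OF J(1)] by blast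
      show "norm (J (T s)) = 1" using T[OF s] J(2) by simp
      have "((\<lambda>s. J (T s)) has_vector_derivative J (k s *\<^sub>R rot90 e\<^sub>1 e\<^sub>2 (T s))) (at s within {0..L})"
        using T[OF s] has_vector_derivative_linear[OF J(1)] by blast
      then show "((\<lambda>s. J (T s)) has_vector_derivative k s *\<^sub>R rot90 (J e\<^sub>1) (J e\<^sub>2) (J (T s))) (at s within {0..L})"
        by (simp add: rot linear_cmul[OF J(1)])
    qed
  qed
  moreover have "orthonormal_pair (J e\<^sub>1) (J e\<^sub>2)"
    using e(1) by (simp add: orthonormal_pair_def inner J(2))
  moreover have "(\<lambda>t. J (\<gamma> t)) ` {a..b} \<subseteq> affine_plane (J p) (J e\<^sub>1) (J e\<^sub>2)"
    using e(2) by (fastforce simp: affine_plane_def linear_add[OF J(1)] linear_cmul[OF J(1)])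
  ultimately show ?thesis
    unfolding half_fold_figure_eight_def Let_def
    using ab(1) immersed_curve_isometry[OF J ab(2)] \<sigma> curv
    by (intro conjI exI[of _ "J p"] exI[of _ "J e\<^sub>1"] exI[of _ "J e\<^sub>2"] exI[of _ "\<lambda>s. J (\<sigma> s)"]) (auto simp: len)
qed

lemma closed_leafed_elastica_isometry:
  fixes J :: "'a::euclidean_space \<Rightarrow> 'b::euclidean_space"
  assumes J: "linear J" "\<And>x. norm (J x) = norm x" and "closed_leafed_elastica k \<gamma>"
  shows "closed_leafed_elastica k (J \<circ> \<gamma>)"
proof -
  obtain t\<^sub>0 c where H2: "closed_H2_curve \<gamma>" "H2_curve 0 1 (\<lambda>t. \<gamma> (t + t\<^sub>0))"
    and imm: "immersed_curve 0 1 (\<lambda>t. \<gamma> (t + t\<^sub>0))"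
    and c: "leaf_partition 0 1 k c (\<lambda>t. \<gamma> (t + t\<^sub>0))"
    using assms(3) unfolding closed_leafed_elastica_def leafed_elastica_def by blast
  have "curve_length (c i) (c (Suc i)) (\<lambda>t. J (\<gamma> (t + t\<^sub>0))) = curve_length (c i) (c (Suc i)) (\<lambda>t. \<gamma> (t + t\<^sub>0))"
    if "i < k" for i
    using c that unfolding leaf_partition_def half_fold_figure_eight_def
    by (intro arclength_isometry[OF J]) auto
  moreover have "half_fold_figure_eight (c i) (c (Suc i)) (\<lambda>t. J (\<gamma> (t + t\<^sub>0)))" if "i < k" for i
    by (rule half_fold_figure_eight_isometry[OF J]) (use c that in \<open>auto simp: leaf_partition_def\<close>)
  ultimately have "leaf_partition 0 1 k c (\<lambda>t. J (\<gamma> (t + t\<^sub>0)))"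
    using c unfolding leaf_partition_def by (intro conjI allI impI) metis+
  moreover have "H2_curve a b (\<lambda>t. J (\<gamma> t))" if "a < b" for a b
    by (rule H2_curve_isometry[OF J]) (use H2(1) that in \<open>auto simp: closed_H2_curve_def\<close>)
  then have "closed_H2_curve (\<lambda>t. J (\<gamma> t))"
    using H2(1) by (simp add: closed_H2_curve_def)
  ultimately show ?thesis
    unfolding closed_leafed_elastica_def leafed_elastica_def o_def
    using H2_curve_isometry[OF J H2(2)] immersed_curve_isometry[OF J imm]
    by (intro conjI exI[of _ t\<^sub>0] exI[of _ c] zero_less_one)
qed

lemma coord_embedding_isometry:
  assumes "inj \<iota>"
  shows "linear (coord_embedding \<iota>)" "norm (coord_embedding \<iota> x) = norm x"
proof -
  show "linear (coord_embedding \<iota>)"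
    by (rule linearI) (simp_all add: coord_embedding_def scaleR_add_left sum.distrib scaleR_sum_right)
  have ax: "axis (\<iota> i) 1 \<bullet> (axis (\<iota> j) 1 :: real ^ 'a) = (if i = j then 1 else 0)" for i j
    using assms by (auto simp: inner_axis_axis inj_eq)
  have "coord_embedding \<iota> x \<bullet> coord_embedding \<iota> x = (\<Sum>i\<in>UNIV. x $ i * x $ i)"
    by (simp add: coord_embedding_def inner_sum_left inner_sum_right ax if_distrib cong: if_cong)
  also have "\<dots> = x \<bullet> x" by (simp add: inner_vec_def)
  finally have "coord_embedding \<iota> x \<bullet> coord_embedding \<iota> x = x \<bullet> x" .
  then show "norm (coord_embedding \<iota> x) = norm x" by (simp add: norm_eq)
qed

section \<open>Half-fold figure-eights are leaves\<close>

lemma has_vector_derivative_unique_within_Icc: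
  fixes f :: "real \<Rightarrow> 'a::euclidean_space"
  assumes "a < b" "t \<in> {a..b}" "(f has_vector_derivative x) (at t within {a..b})"
    "(f has_vector_derivative y) (at t within {a..b})"
  shows "x = y"
  using vector_derivative_within_closed_interval[OF assms(1,2)] assms(3,4) by metis

lemma constant_if_zero_vector_derivative:
  fixes f :: "real \<Rightarrow> 'a::euclidean_space"
  assumes "\<And>s. s \<in> {a..b} \<Longrightarrow> (f has_vector_derivative 0) (at s within {a..b})" "s \<in> {a..b}"
  shows "f s = f a"
proof -
  obtain c where "\<And>x. x \<in> {a..b} \<Longrightarrow> f x = c"
    using has_vector_derivative_zero_constant[of "{a..b}" f] assms(1) by auto
  then show ?thesis using assms(2) by auto
qed

text \<open>Written in the frame that solves the Frenet equations of the half-fold curvature, the tangent of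
  any solution has constant coordinates.\<close>

lemma half_fold_tangent:
  fixes \<sigma> :: "real \<Rightarrow> 'a::euclidean_space"
  assumes e: "orthonormal_pair e\<^sub>1 e\<^sub>2" and L: "0 < L"
    and plane: "\<And>s. s \<in> {0..L} \<Longrightarrow> \<sigma> s \<in> affine_plane p e\<^sub>1 e\<^sub>2"
    and curv: "has_signed_curvature e\<^sub>1 e\<^sub>2 L \<sigma> (\<lambda>s. 2 * K_star / L * curv (2 * K_star / L * s - K_star))"
  obtains w w' where "norm w = 1" "norm w' = 1" "w \<bullet> w' = cos (2 * phi_star)"
    "\<And>s. s \<in> {0..L} \<Longrightarrow> (\<sigma> has_vector_derivative leaf_tangent w w' (s / L)) (at s within {0..L})"
    "\<And>s. s \<in> {0..L} \<Longrightarrow> \<sigma> s = \<sigma> 0 + L *\<^sub>R leaf w w' (s / L)"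
proof -
  define \<Lambda> where "\<Lambda> = 2 * K_star / L"
  obtain T where T: "\<And>s. s \<in> {0..L} \<Longrightarrow> (\<sigma> has_vector_derivative T s) (at s within {0..L})"
      "\<And>s. s \<in> {0..L} \<Longrightarrow> norm (T s) = 1"
      "\<And>s. s \<in> {0..L} \<Longrightarrow> (T has_vector_derivative (\<Lambda> * curv (\<Lambda> * s - K_star)) *\<^sub>R rot90 e\<^sub>1 e\<^sub>2 (T s)) (at s within {0..L})"
    using curv unfolding has_signed_curvature_def \<Lambda>_def by blast
  have ee: "e\<^sub>1 \<bullet> e\<^sub>1 = 1" "e\<^sub>2 \<bullet> e\<^sub>2 = 1" "e\<^sub>1 \<bullet> e\<^sub>2 = 0" "e\<^sub>2 \<bullet> e\<^sub>1 = 0"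
    using e by (auto simp: orthonormal_pair_def norm_eq_1 inner_commute)
  \<comment> \<open>\<open>rot90\<close> sees only the component in the plane, so the curvature
    equation does not control the normal part of T. It vanishes because the projection \<rho> to the
    orthogonal complement is constant along \<sigma>.\<close>
  have T_plane: "T s = (T s \<bullet> e\<^sub>1) *\<^sub>R e\<^sub>1 + (T s \<bullet> e\<^sub>2) *\<^sub>R e\<^sub>2" if s: "s \<in> {0..L}" for s
  proof -
    define \<rho> where "\<rho> = (\<lambda>x. x - ((x \<bullet> e\<^sub>1) *\<^sub>R e\<^sub>1 + (x \<bullet> e\<^sub>2) *\<^sub>R e\<^sub>2))"
    have lin: "linear \<rho>"
      unfolding \<rho>_def by (rule linearI) (simp_all add: inner_simps algebra_simps)
    have "\<rho> (\<sigma> s) = \<rho> p" if s: "s \<in> {0..L}" for s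
      using plane[OF s] by (auto simp: affine_plane_def \<rho>_def inner_simps ee algebra_simps)
    then have "((\<lambda>s. \<rho> (\<sigma> s)) has_vector_derivative 0) (at s within {0..L})"
      using s by (intro has_vector_derivative_transform[OF s _ has_vector_derivative_const[of "\<rho> p"]]) auto
    with has_vector_derivative_linear[OF lin T(1)[OF s]] have "\<rho> (T s) = 0"
      using has_vector_derivative_unique_within_Icc[OF L s] by blast
    then show ?thesis by (simp add: \<rho>_def)
  qed
  define t\<^sub>1 t\<^sub>2 where "t\<^sub>1 = (\<lambda>s. T s \<bullet> e\<^sub>1)" and "t\<^sub>2 = (\<lambda>s. T s \<bullet> e\<^sub>2)"
  define k where "k = (\<lambda>s. \<Lambda> * curv (\<Lambda> * s - K_star))"
  define u v where "u = (\<lambda>s. tan_x (\<Lambda> * s - K_star))" and "v = (\<lambda>s. tan_y (\<Lambda> * s - K_star))"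
  have uv: "(u s)\<^sup>2 + (v s)\<^sup>2 = 1" for s by (simp add: u_def v_def tan_unit)
  have der: "(t\<^sub>1 has_real_derivative - k s * t\<^sub>2 s) (at s within {0..L})"
      "(t\<^sub>2 has_real_derivative k s * t\<^sub>1 s) (at s within {0..L})" if "s \<in> {0..L}" for s
    using bounded_linear.has_vector_derivative[OF bounded_linear_inner_left T(3)[OF that], of e\<^sub>1]
      bounded_linear.has_vector_derivative[OF bounded_linear_inner_left T(3)[OF that], of e\<^sub>2]
    by (simp_all add: t\<^sub>1_def t\<^sub>2_def k_def rot90_def inner_simps ee has_real_derivative_iff_has_vector_derivative)
  have lin: "((\<lambda>s. \<Lambda> * s - K_star) has_real_derivative \<Lambda>) (at s within S)" for s S
    by (auto intro!: derivative_eq_intros)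
  have duv: "(u has_real_derivative - k s * v s) (at s within {0..L})"
      "(v has_real_derivative k s * u s) (at s within {0..L})" for s
    using DERIV_chain2[OF tan_x_has_real_derivative lin[of s "{0..L}"]]
      DERIV_chain2[OF tan_y_has_real_derivative lin[of s "{0..L}"]]
    by (simp_all add: u_def v_def k_def mult_ac)
  \<comment> \<open>In complex notation this is (t1 + i t2)(u - i v), the rotation from the model
    tangent to the actual one; both turn at the rate k.\<close>
  define c\<^sub>1 c\<^sub>2 where "c\<^sub>1 = t\<^sub>1 0 * u 0 + t\<^sub>2 0 * v 0" and "c\<^sub>2 = t\<^sub>2 0 * u 0 - t\<^sub>1 0 * v 0"
  have c: "t\<^sub>1 s * u s + t\<^sub>2 s * v s = c\<^sub>1" "t\<^sub>2 s * u s - t\<^sub>1 s * v s = c\<^sub>2" if "s \<in> {0..L}" for s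
  proof -
    have "((\<lambda>s. t\<^sub>1 s * u s + t\<^sub>2 s * v s) has_vector_derivative 0) (at s within {0..L})" if "s \<in> {0..L}" for s
      using DERIV_add[OF DERIV_mult[OF der(1)[OF that] duv(1)] DERIV_mult[OF der(2)[OF that] duv(2)]]
      by (simp add: has_real_derivative_iff_has_vector_derivative[symmetric] algebra_simps)
    then show "t\<^sub>1 s * u s + t\<^sub>2 s * v s = c\<^sub>1"
      unfolding c\<^sub>1_def by (rule constant_if_zero_vector_derivative[OF _ that])
    have "((\<lambda>s. t\<^sub>2 s * u s - t\<^sub>1 s * v s) has_vector_derivative 0) (at s within {0..L})" if "s \<in> {0..L}" for s
      using DERIV_diff[OF DERIV_mult[OF der(2)[OF that] duv(1)] DERIV_mult[OF der(1)[OF that] duv(2)]]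
      by (simp add: has_real_derivative_iff_has_vector_derivative[symmetric] algebra_simps)
    then show "t\<^sub>2 s * u s - t\<^sub>1 s * v s = c\<^sub>2"
      unfolding c\<^sub>2_def by (rule constant_if_zero_vector_derivative[OF _ that])
  qed
  have t: "t\<^sub>1 s = c\<^sub>1 * u s - c\<^sub>2 * v s" "t\<^sub>2 s = c\<^sub>1 * v s + c\<^sub>2 * u s" if "s \<in> {0..L}" for s
  proof -
    have "t\<^sub>1 s * ((u s)\<^sup>2 + (v s)\<^sup>2) = c\<^sub>1 * u s - c\<^sub>2 * v s" "t\<^sub>2 s * ((u s)\<^sup>2 + (v s)\<^sup>2) = c\<^sub>1 * v s + c\<^sub>2 * u s"
      unfolding c[OF that, symmetric] by (simp_all add: algebra_simps power2_eq_square)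
    then show "t\<^sub>1 s = c\<^sub>1 * u s - c\<^sub>2 * v s" "t\<^sub>2 s = c\<^sub>1 * v s + c\<^sub>2 * u s" by (simp_all add: uv)
  qed
  define f g where "f = c\<^sub>1 *\<^sub>R e\<^sub>1 + c\<^sub>2 *\<^sub>R e\<^sub>2" and "g = c\<^sub>1 *\<^sub>R e\<^sub>2 - c\<^sub>2 *\<^sub>R e\<^sub>1"
  have Tfg: "T s = u s *\<^sub>R f + v s *\<^sub>R g" if "s \<in> {0..L}" for s
    using T_plane[OF that] t[OF that] unfolding t\<^sub>1_def t\<^sub>2_def f_def g_def by (simp add: algebra_simps)
  have "c\<^sub>1\<^sup>2 + c\<^sub>2\<^sup>2 = 1"
  proof -
    have "0 \<in> {0..L}" using L by simp
    have "(t\<^sub>1 0)\<^sup>2 + (t\<^sub>2 0)\<^sup>2 = T 0 \<bullet> T 0"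
      by (subst (2) T_plane[OF \<open>0 \<in> {0..L}\<close>])
        (simp add: t\<^sub>1_def t\<^sub>2_def inner_simps power2_eq_square)
    also have "\<dots> = 1" using T(2)[OF \<open>0 \<in> {0..L}\<close>] by (simp add: norm_eq_1)
    finally have "(t\<^sub>1 0)\<^sup>2 + (t\<^sub>2 0)\<^sup>2 = 1" .
    moreover have "c\<^sub>1\<^sup>2 + c\<^sub>2\<^sup>2 = ((t\<^sub>1 0)\<^sup>2 + (t\<^sub>2 0)\<^sup>2) * ((u 0)\<^sup>2 + (v 0)\<^sup>2)"
      unfolding c\<^sub>1_def c\<^sub>2_def by (simp add: algebra_simps power2_eq_square)
    ultimately show ?thesis by (simp add: uv)
  qed
  then have fg: "f \<bullet> f = 1" "g \<bullet> g = 1" "f \<bullet> g = 0" "g \<bullet> f = 0"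
    by (simp_all add: f_def g_def inner_simps ee power2_eq_square)
  define w w' where "w = end_x *\<^sub>R f - end_y *\<^sub>R g" and "w' = end_x *\<^sub>R f + end_y *\<^sub>R g"
  have axes: "axis_x w w' = f" "axis_y w w' = g"
    by (simp_all add: w_def w'_def axes_of_frame)
  have tan: "leaf_tangent w w' (s / L) = T s" if "s \<in> {0..L}" for s
    by (simp add: leaf_tangent_def axes Tfg[OF that] u_def v_def \<Lambda>_def)
  have const: "\<sigma> s - L *\<^sub>R leaf w w' (s / L) = \<sigma> 0 - L *\<^sub>R leaf w w' (0 / L)" if "s \<in> {0..L}" for s
  proof (rule constant_if_zero_vector_derivative[OF _ that])
    fix s assume s: "s \<in> {0..L}"
    have "((\<lambda>s. s / L) has_real_derivative 1 / L) (at s within {0..L})"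
      using L by (auto intro!: derivative_eq_intros)
    then have "((\<lambda>s. leaf w w' (s / L)) has_vector_derivative (1 / L) *\<^sub>R leaf_tangent w w' (s / L)) (at s within {0..L})"
      by (rule has_vector_derivative_chain_within[OF _ leaf_has_vector_derivative subset_UNIV])
    then have "((\<lambda>s. L *\<^sub>R leaf w w' (s / L)) has_vector_derivative L *\<^sub>R (1 / L) *\<^sub>R leaf_tangent w w' (s / L)) (at s within {0..L})"
      by (rule bounded_linear.has_vector_derivative[OF bounded_linear_scaleR_right])
    from has_vector_derivative_diff[OF T(1)[OF s] this]
    show "((\<lambda>s. \<sigma> s - L *\<^sub>R leaf w w' (s / L)) has_vector_derivative 0) (at s within {0..L})"
      using L by (simp add: tan[OF s])
  qed
  have leaf: "\<sigma> s = \<sigma> 0 + L *\<^sub>R leaf w w' (s / L)" if "s \<in> {0..L}" for s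
    using const[OF that] by (simp add: leaf_ends algebra_simps)
  have tangent: "(\<sigma> has_vector_derivative leaf_tangent w w' (s / L)) (at s within {0..L})" if "s \<in> {0..L}" for s
    using T(1)[OF that] tan[OF that] by simp
  have "norm w = 1" "norm w' = 1" "w \<bullet> w' = cos (2 * phi_star)"
    using end_unit end_angle
    by (simp_all add: norm_eq_1 w_def w'_def inner_simps fg power2_eq_square)
  then show thesis by (rule that[OF _ _ _ tangent leaf])
qed

lemma curv_eq_jacobi_cn: "2 * sqrt m_star * \<Lambda> * jacobi_cn y m_star = \<Lambda> * curv y"
  by (simp add: curv_def jacobi_cn_def)

lemma has_real_derivative_pos_imp_less_within:
  fixes S :: "real \<Rightarrow> real"
  assumes "\<And>t. t \<in> {a..b} \<Longrightarrow> (S has_real_derivative S' t) (at t within {a..b})"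
    and "\<And>t. t \<in> {a..b} \<Longrightarrow> 0 < S' t" "a \<le> x" "x < y" "y \<le> b"
  shows "S x < S y"
proof (rule DERIV_pos_imp_increasing_open[OF \<open>x < y\<close>])
  fix z assume "x < z" "z < y"
  then have "z \<in> {a..b}" "at z within {a..b} = at z" using assms(3,5) by (auto intro: at_within_Icc_at)
  then show "\<exists>d. (S has_real_derivative d) (at z) \<and> 0 < d"
    using assms(1,2)[of z] by auto
next
  show "continuous_on {x..y} S"
    by (rule continuous_on_subset[OF DERIV_continuous_on[OF assms(1)]]) (use assms in auto)
qed

text \<open>S is any antiderivative of the speed rather than the arclength of this leaf, so that one
  function can serve all leaves of a curve.\<close>

lemma half_fold_figure_eight_eq_leaf:
  fixes \<gamma> :: "real \<Rightarrow> 'a::euclidean_space"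
  assumes hf: "half_fold_figure_eight a b \<gamma>"
    and D: "\<And>t. t \<in> {a..b} \<Longrightarrow> (\<gamma> has_vector_derivative D t) (at t within {a..b})"
    and nz: "\<And>t. t \<in> {a..b} \<Longrightarrow> D t \<noteq> 0"
    and S: "\<And>t. t \<in> {a..b} \<Longrightarrow> (S has_real_derivative norm (D t)) (at t within {a..b})"
  shows "S a < S b" "sgn (D a) \<bullet> sgn (D b) = cos (2 * phi_star)"
    "\<And>t. t \<in> {a..b} \<Longrightarrow> S a \<le> S t \<and> S t \<le> S b"
    "\<And>t. t \<in> {a..b} \<Longrightarrow>
      \<gamma> t = \<gamma> a + (S b - S a) *\<^sub>R leaf (sgn (D a)) (sgn (D b)) ((S t - S a) / (S b - S a))"
proof -
  define L where "L = S b - S a"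
  have "a < b" using hf by (simp add: half_fold_figure_eight_def)
  note len = arclength_eq[OF \<open>a < b\<close> D S]
  have less: "S x < S y" if "a \<le> x" "x < y" "y \<le> b" for x y
    using has_real_derivative_pos_imp_less_within[OF S _ that] nz by simp
  show "S a < S b" using less \<open>a < b\<close> by simp
  then have "0 < L" by (simp add: L_def)
  show bounds: "S a \<le> S t \<and> S t \<le> S b" if "t \<in> {a..b}" for t
    using less[of a t] less[of t b] that by (cases "t = a"; cases "t = b") auto
  have curve_length: "curve_length a b \<gamma> = L" using len[of b] \<open>a < b\<close> by (simp add: L_def)
  obtain p e\<^sub>1 e\<^sub>2 \<sigma> where e: "orthonormal_pair e\<^sub>1 e\<^sub>2" and plane: "\<gamma> ` {a..b} \<subseteq> affine_plane p e\<^sub>1 e\<^sub>2"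
    and \<sigma>: "\<forall>t\<in>{a..b}. \<gamma> t = \<sigma> (arclength a b \<gamma> t)"
    and curv: "has_signed_curvature e\<^sub>1 e\<^sub>2 L \<sigma>
      (\<lambda>s. 2 * K_star / L * curv (2 * K_star / L * s - K_star))"
    using hf unfolding half_fold_figure_eight_def Let_def curve_length curv_eq_jacobi_cn by blast
  have \<gamma>: "\<gamma> t = \<sigma> (S t - S a)" if "t \<in> {a..b}" for t using \<sigma> len[of t] that by simp
  have "\<sigma> s \<in> affine_plane p e\<^sub>1 e\<^sub>2" if "s \<in> {0..L}" for s
  proof -
    \<comment> \<open>Only \<gamma> is known to lie in the plane; this carries the property over to
      \<sigma>, since every arclength in [0, L] is attained.\<close>
    have "\<exists>t. a \<le> t \<and> t \<le> b \<and> S t = S a + s"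
      using that \<open>a < b\<close> by (intro IVT' DERIV_continuous_on[OF S]) (auto simp: L_def)
    then show ?thesis using \<gamma> plane by force
  qed
  then obtain w w' where w: "norm w = 1" "norm w' = 1" "w \<bullet> w' = cos (2 * phi_star)"
    and tan: "\<And>s. s \<in> {0..L} \<Longrightarrow> (\<sigma> has_vector_derivative leaf_tangent w w' (s / L)) (at s within {0..L})"
    and leaf: "\<And>s. s \<in> {0..L} \<Longrightarrow> \<sigma> s = \<sigma> 0 + L *\<^sub>R leaf w w' (s / L)"
    using half_fold_tangent[OF e \<open>0 < L\<close> _ curv] by metis
  have sgn: "sgn (D t) = leaf_tangent w w' ((S t - S a) / L)" if t: "t \<in> {a..b}" for t
  proof -
    have "((\<lambda>t. S t - S a) has_real_derivative norm (D t)) (at t within {a..b})"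
      using DERIV_diff[OF S[OF t] DERIV_const] by simp
    moreover have "S t - S a \<in> {0..L}" using bounds[OF t] by (simp add: L_def)
    ultimately have "((\<lambda>t. \<sigma> (S t - S a)) has_vector_derivative norm (D t) *\<^sub>R leaf_tangent w w' ((S t - S a) / L)) (at t within {a..b})"
      using bounds by (intro has_vector_derivative_chain_within[OF _ tan]) (auto simp: L_def)
    then have "(\<gamma> has_vector_derivative norm (D t) *\<^sub>R leaf_tangent w w' ((S t - S a) / L)) (at t within {a..b})"
      using \<gamma> t by (intro has_vector_derivative_transform[of t "{a..b}" \<gamma> "\<lambda>t. \<sigma> (S t - S a)"]) auto
    then have "D t = norm (D t) *\<^sub>R leaf_tangent w w' ((S t - S a) / L)"
      using has_vector_derivative_unique_within_Icc[OF \<open>a < b\<close> t D[OF t]] by blast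
    then show ?thesis using nz[OF t] by (metis norm_eq_zero scaleR_one scaleR_scaleR sgn_div_norm left_inverse)
  qed
  have "sgn (D a) = w" using sgn[of a] \<open>a < b\<close> by (simp add: leaf_ends)
  moreover have "sgn (D b) = w'" using sgn[of b] \<open>a < b\<close> \<open>0 < L\<close> by (simp add: leaf_ends flip: L_def)
  ultimately show "sgn (D a) \<bullet> sgn (D b) = cos (2 * phi_star)" using w by simp
  show "\<gamma> t = \<gamma> a + (S b - S a) *\<^sub>R leaf (sgn (D a)) (sgn (D b)) ((S t - S a) / (S b - S a))"
      if "t \<in> {a..b}" for t
  proof -
    have "S t - S a \<in> {0..L}" using bounds[OF that] by (simp add: L_def)
    from leaf[OF this] show "\<gamma> t = \<gamma> a + (S b - S a) *\<^sub>R leaf (sgn (D a)) (sgn (D b)) ((S t - S a) / (S b - S a))"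
      using \<gamma>[OF that] \<gamma>[of a] \<open>a < b\<close> \<open>sgn (D a) = w\<close> \<open>sgn (D b) = w'\<close> by (simp flip: L_def)
  qed
qed

section \<open>Chains of leaves\<close>

text \<open>No translations between the pieces are needed, because every leaf starts and ends at 0.
  Integer indices put the chain on the whole line, where closedness becomes periodicity of the
  directions.\<close>

definition leaf_chain :: "(int \<Rightarrow> 'a::euclidean_space) \<Rightarrow> real \<Rightarrow> 'a" where
  "leaf_chain \<omega> = glue (\<lambda>j. leaf (\<omega> j) (\<omega> (j + 1)))"

definition leaf_chain_tangent :: "(int \<Rightarrow> 'a::euclidean_space) \<Rightarrow> real \<Rightarrow> 'a" where
  "leaf_chain_tangent \<omega> = glue (\<lambda>j. leaf_tangent (\<omega> j) (\<omega> (j + 1)))"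

definition leaf_chain_accel :: "(int \<Rightarrow> 'a::euclidean_space) \<Rightarrow> real \<Rightarrow> 'a" where
  "leaf_chain_accel \<omega> = glue (\<lambda>j x. leaf_curvature x *\<^sub>R leaf_normal (\<omega> j) (\<omega> (j + 1)) x)"

lemma leaf_chain_eq:
  assumes "x \<in> {of_int j..of_int j + 1}"
  shows "leaf_chain \<omega> x = leaf (\<omega> j) (\<omega> (j + 1)) (x - of_int j)"
    "leaf_chain_tangent \<omega> x = leaf_tangent (\<omega> j) (\<omega> (j + 1)) (x - of_int j)"
  unfolding leaf_chain_def leaf_chain_tangent_def
  by (rule glue_eq[OF _ assms]; simp add: leaf_ends)+

lemma leaf_chain_of_int: "leaf_chain \<omega> (of_int j) = 0" "leaf_chain_tangent \<omega> (of_int j) = \<omega> j"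
  by (simp_all add: leaf_chain_eq[of "of_int j" j] leaf_ends)

lemma leaf_chain_has_vector_derivative:
  "(leaf_chain \<omega> has_vector_derivative leaf_chain_tangent \<omega> x) (at x)"
  unfolding leaf_chain_def leaf_chain_tangent_def
  by (rule glue_has_vector_derivative) (simp_all add: leaf_ends leaf_has_vector_derivative)

lemma leaf_chain_tangent_has_vector_derivative:
  "(leaf_chain_tangent \<omega> has_vector_derivative leaf_chain_accel \<omega> x) (at x)"
  unfolding leaf_chain_tangent_def leaf_chain_accel_def
  by (rule glue_has_vector_derivative) (simp_all add: leaf_ends leaf_tangent_has_vector_derivative)

lemma continuous_on_leaf_chain_accel: "continuous_on UNIV (leaf_chain_accel \<omega>)"
  unfolding leaf_chain_accel_def
proof (rule continuous_on_glue)
  have c: "continuous_on UNIV curv" "continuous_on UNIV tan_x" "continuous_on UNIV tan_y"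
    by (rule DERIV_continuous_on, rule has_field_derivative_at_within,
        rule curv_has_real_derivative tan_x_has_real_derivative tan_y_has_real_derivative)+
  show "continuous_on {0..1} (\<lambda>x. leaf_curvature x *\<^sub>R leaf_normal (\<omega> j) (\<omega> (j + 1)) x)" for j
    unfolding leaf_curvature_def leaf_normal_def
    by (intro continuous_intros continuous_on_compose2[OF c(1)] continuous_on_compose2[OF c(2)]
        continuous_on_compose2[OF c(3)]) auto
qed (simp add: leaf_ends)

lemma norm_leaf_chain_tangent:
  assumes "\<And>j. norm (\<omega> j) = 1" "\<And>j. \<omega> j \<bullet> \<omega> (j + 1) = cos (2 * phi_star)"
  shows "norm (leaf_chain_tangent \<omega> x) = 1"
  unfolding leaf_chain_tangent_def glue_def by (rule norm_leaf_tangent) (rule assms)+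

lemma leaf_chain_periodic:
  assumes "\<And>j. \<omega> (j + k) = \<omega> j"
  shows "leaf_chain \<omega> (x + of_int k) = leaf_chain \<omega> x"
proof -
  have "\<omega> (j + k + 1) = \<omega> (j + 1)" for j using assms[of "j + 1"] by (simp add: ac_simps)
  then show ?thesis unfolding leaf_chain_def by (intro glue_add_int) (simp add: assms)
qed

lemma leaf_chain_linear: "linear R \<Longrightarrow> R (leaf_chain \<omega> x) = leaf_chain (\<lambda>j. R (\<omega> j)) x"
  by (simp add: leaf_chain_def glue_def leaf_linear)

lemma less_3_cases: "i < 3 \<Longrightarrow> i = 0 \<or> i = 1 \<or> i = (2::nat)"
  by auto

text \<open>Prescribing the angle of neighbours suffices: modulo 3, any two distinct indices are
  neighbours.\<close>

definition leaf_directions :: "(int \<Rightarrow> 'a::euclidean_space) \<Rightarrow> bool" where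
  "leaf_directions \<omega> \<longleftrightarrow> (\<forall>j. norm (\<omega> j) = 1 \<and> \<omega> (j + 3) = \<omega> j \<and> \<omega> j \<bullet> \<omega> (j + 1) = cos (2 * phi_star))"

lemma leaf_directions_mod: "leaf_directions \<omega> \<Longrightarrow> \<omega> (j mod 3) = \<omega> j"
proof -
  assume \<omega>: "leaf_directions \<omega>"
  have "\<omega> (i + 3 * k) = \<omega> i" for i k :: int
  proof (induction k rule: int_induct[of _ 0])
    case (step1 k)
    have "\<omega> (i + 3 * k + 3) = \<omega> (i + 3 * k)" using \<omega> by (simp add: leaf_directions_def)
    then show ?case using step1 by (simp add: algebra_simps)
  next
    case (step2 k)
    have "\<omega> (i + 3 * (k - 1) + 3) = \<omega> (i + 3 * (k - 1))" using \<omega> unfolding leaf_directions_def by blast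
    then show ?case using step2 by (simp add: algebra_simps)
  qed simp
  from this[of "j mod 3" "j div 3"] show ?thesis by simp
qed

lemma leaf_directions_inner:
  assumes "leaf_directions \<omega>" "i < 3" "j < 3"
  shows "\<omega> (int i) \<bullet> \<omega> (int j) = (if i = j then 1 else cos (2 * phi_star))"
proof -
  have \<omega>: "norm (\<omega> j) = 1" "\<omega> (j + 3) = \<omega> j" "\<omega> j \<bullet> \<omega> (j + 1) = cos (2 * phi_star)" for j
    using assms(1) by (auto simp: leaf_directions_def)
  show ?thesis
    using less_3_cases[OF assms(2)] less_3_cases[OF assms(3)]
      \<omega>(1)[of "int i"] \<omega>(2)[of 0] \<omega>(3)[of 0] \<omega>(3)[of 1] \<omega>(3)[of 2]
    by (auto simp: norm_eq_1 inner_commute)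
qed

lemma leaf_partition_eq_leaf_chain:
  fixes g :: "real \<Rightarrow> 'a::euclidean_space"
  assumes part: "leaf_partition 0 1 3 c g"
    and D: "\<And>t. (g has_vector_derivative D t) (at t)" "\<And>t. D t \<noteq> 0" "D 1 = D 0"
    and S: "\<And>t. (S has_real_derivative norm (D t)) (at t)"
  obtains L \<omega> where "0 < L" "leaf_directions \<omega>" "S 1 - S 0 = 3 * L"
    "\<And>t. t \<in> {0..1} \<Longrightarrow> g t = g 0 + L *\<^sub>R leaf_chain \<omega> ((S t - S 0) / L)"
proof -
  have c: "c 0 = 0" "c 3 = 1"
    and hf: "\<And>i. i < 3 \<Longrightarrow> half_fold_figure_eight (c i) (c (Suc i)) g"
    and eq: "\<And>i j. i < 3 \<Longrightarrow> j < 3 \<Longrightarrow> curve_length (c i) (c (Suc i)) g = curve_length (c j) (c (Suc j)) g"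
    and less: "\<And>i. i < 3 \<Longrightarrow> c i < c (Suc i)"
    using part unfolding leaf_partition_def by blast+
  define L where "L = S (c 1) - S (c 0)"
  define \<omega> where "\<omega> = (\<lambda>j::int. sgn (D (c (nat (j mod 3)))))"
  note leaf = half_fold_figure_eight_eq_leaf[OF hf has_vector_derivative_at_within[OF D(1)] D(2)
      has_field_derivative_at_within[OF S]]
  have "curve_length (c i) (c (Suc i)) g = S (c (Suc i)) - S (c i)" if "i < 3" for i
    by (rule arclength_eq[OF less[OF that] has_vector_derivative_at_within[OF D(1)] has_field_derivative_at_within[OF S]])
      (use less[OF that] in auto)
  then have len: "S (c (Suc i)) - S (c i) = L" if "i < 3" for i
    using eq[OF that, of 0] that by (simp add: L_def)
  have "0 < L" using leaf(1)[of 0] by (simp add: L_def)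
  have Sc: "S (c i) = S 0 + real i * L" if "i \<le> 3" for i
    using that
  proof (induction i)
    case (Suc i)
    then show ?case using len[of i] by (simp add: algebra_simps)
  qed (simp add: c)
  \<comment> \<open>At i = 3 the index wraps around to 0; the formula survives because the
    derivative takes the same value at 0 and 1.\<close>
  have \<omega>c: "\<omega> (int i) = sgn (D (c i))" if "i \<le> 3" for i
    using that c D(3) by (cases "i = 3") (auto simp: \<omega>_def nat_mod_distrib zmod_int)
  \<comment> \<open>Each leaf returns to its starting point.\<close>
  have gc: "g (c i) = g 0" if "i \<le> 3" for i
    using that
  proof (induction i)
    case (Suc i)
    then show ?case using leaf(4)[of i "c (Suc i)"] less[of i] len[of i] \<open>0 < L\<close> by (simp add: leaf_ends)
  qed (simp add: c)
  have dirs: "leaf_directions \<omega>"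
    unfolding leaf_directions_def
  proof (intro allI conjI)
    fix j :: int
    have mod: "\<omega> j = \<omega> (int (nat (j mod 3)))" "\<omega> (j + 1) = \<omega> (int (Suc (nat (j mod 3))))" for j
      by (simp_all add: \<omega>_def mod_simps add.commute)
    have "nat (j mod 3) < 3" by (simp add: nat_less_iff)
    then have "\<omega> (int (nat (j mod 3))) \<bullet> \<omega> (int (Suc (nat (j mod 3)))) = cos (2 * phi_star)"
      using leaf(2)[of "nat (j mod 3)"] by (subst (1 2) \<omega>c) auto
    then show "\<omega> j \<bullet> \<omega> (j + 1) = cos (2 * phi_star)" by (simp only: mod[symmetric])
    show "norm (\<omega> j) = 1" using D(2) by (simp add: \<omega>_def norm_sgn)
    show "\<omega> (j + 3) = \<omega> j" by (simp add: \<omega>_def)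
  qed
  have chain: "g t = g 0 + L *\<^sub>R leaf_chain \<omega> ((S t - S 0) / L)" if t: "t \<in> {0..1}" for t
  proof -
    have "\<exists>i<3. t \<in> {c i..c (Suc i)}"
    proof -
      have "t \<le> c 1 \<or> c 1 \<le> t \<and> t \<le> c 2 \<or> c 2 \<le> t" by linarith
      then show ?thesis
        using t c by (auto simp: numeral_eq_Suc less_Suc_eq)
    qed
    then obtain i where i: "i < 3" "t \<in> {c i..c (Suc i)}" by blast
    have x: "(S t - S (c i)) / L = (S t - S 0) / L - of_int (int i)"
      using i \<open>0 < L\<close> by (simp add: Sc field_simps)
    have "0 \<le> (S t - S (c i)) / L" "(S t - S (c i)) / L \<le> 1"
      using leaf(3)[OF i] len[OF i(1)] \<open>0 < L\<close> by auto
    then have chain: "leaf_chain \<omega> ((S t - S 0) / L) = leaf (\<omega> (int i)) (\<omega> (int i + 1)) ((S t - S (c i)) / L)"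
      unfolding x by (intro leaf_chain_eq) auto
    have "int i + 1 = int (Suc i)" by simp
    show ?thesis
      unfolding chain \<open>int i + 1 = int (Suc i)\<close>
      using leaf(4)[OF i] i(1) by (simp add: \<omega>c len gc del: of_nat_Suc)
  qed
  have "S 1 - S 0 = 3 * L" using Sc[of 3] c by simp
  then show thesis by (rule that[OF \<open>0 < L\<close> dirs _ chain])
qed

section \<open>Elastic propellers\<close>

lemma leaf_directions_exist: "\<exists>\<omega> :: int \<Rightarrow> real ^ 3. leaf_directions \<omega>"
proof -
  define c where "c = cos (2 * phi_star)"
  have "1 + 2 * c = (4 * m_star - 1) * (4 * m_star - 3)"
    unfolding c_def phi_star_cos by (simp add: algebra_simps power2_eq_square)
  then have "0 \<le> 1 + 2 * c" using m_star_props(1) by simp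
  define \<beta> where "\<beta> = sqrt (1 - c)"
  \<comment> \<open>The ansatz \<alpha>(1,1,1) + \<beta> e_i has inner products
    \<open>3 * \<alpha>\<^sup>2 + 2 * \<alpha> * \<beta>\<close>, plus
    \<open>\<beta>\<^sup>2\<close> on the diagonal. Requiring c and 1 gives
    \<open>\<beta>\<^sup>2 = 1 - c\<close> and
    \<open>(3 * \<alpha> + \<beta>)\<^sup>2 = 1 + 2 * c\<close>.\<close>
  define \<alpha> where "\<alpha> = (sqrt (1 + 2 * c) - \<beta>) / 3"
  have \<beta>: "\<beta>\<^sup>2 = 1 - c" by (simp add: \<beta>_def c_def)
  have "(3 * \<alpha> + \<beta>)\<^sup>2 = 1 + 2 * c" using \<open>0 \<le> 1 + 2 * c\<close> by (simp add: \<alpha>_def diff_divide_distrib)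
  then have \<alpha>: "3 * \<alpha>\<^sup>2 + 2 * \<alpha> * \<beta> = c"
    using \<beta> by (simp add: power2_eq_square algebra_simps)
  define v where "v = (\<lambda>i::3. \<alpha> *\<^sub>R (1 :: real ^ 3) + \<beta> *\<^sub>R axis i 1)"
  \<comment> \<open>Arithmetic in the index type is modulo 3, so \<open>of_int\<close> supplies the
    periodicity of the directions.\<close>
  have three: "(3 :: 3) = 0" by simp
  have ax: "axis i (1 :: real) $ j = (if i = j then 1 else 0)" for i j :: 3
    by (simp add: axis_def eq_commute)
  have "(1 :: real ^ 3) \<bullet> 1 = 3" by (simp add: inner_vec_def)
  then have v: "v i \<bullet> v j = 3 * \<alpha>\<^sup>2 + 2 * \<alpha> * \<beta> + (if i = j then \<beta>\<^sup>2 else 0)" for i j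
    by (simp add: v_def inner_simps inner_axis inner_axis' ax power2_eq_square algebra_simps)
  have "leaf_directions (\<lambda>j. v (of_int j))"
    unfolding leaf_directions_def norm_eq_1 v \<alpha> by (simp add: \<beta> c_def three)
  then show ?thesis by blast
qed

text \<open>Three unit leaves have length 3; the scaling by 1/3 gives period 1 and keeps unit
  speed.\<close>

definition propeller :: "(int \<Rightarrow> 'a::euclidean_space) \<Rightarrow> real \<Rightarrow> 'a" where
  "propeller \<omega> t = (1 / 3) *\<^sub>R leaf_chain \<omega> (3 * t)"

lemma propeller_has_vector_derivative:
  "(propeller \<omega> has_vector_derivative leaf_chain_tangent \<omega> (3 * t)) (at t)"
proof -
  have "((\<lambda>t. 3 * t) has_real_derivative 3) (at t)" by (auto intro!: derivative_eq_intros)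
  from has_vector_derivative_chain_within[OF this leaf_chain_has_vector_derivative subset_UNIV]
  have "((\<lambda>t. leaf_chain \<omega> (3 * t)) has_vector_derivative 3 *\<^sub>R leaf_chain_tangent \<omega> (3 * t)) (at t)" .
  from bounded_linear.has_vector_derivative[OF bounded_linear_scaleR_right this, of "1 / 3"]
  show ?thesis by (simp add: propeller_def[abs_def])
qed

lemma propeller_tangent_has_vector_derivative:
  "((\<lambda>t. leaf_chain_tangent \<omega> (3 * t)) has_vector_derivative 3 *\<^sub>R leaf_chain_accel \<omega> (3 * t)) (at t)"
proof -
  have "((\<lambda>t. 3 * t) has_real_derivative 3) (at t)" by (auto intro!: derivative_eq_intros)
  from has_vector_derivative_chain_within[OF this leaf_chain_tangent_has_vector_derivative subset_UNIV]
  show ?thesis .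
qed

lemma H2_curve_propeller: "a \<le> b \<Longrightarrow> H2_curve a b (propeller \<omega>)"
proof (rule H2_curve_C2[OF _ propeller_has_vector_derivative propeller_tangent_has_vector_derivative])
  show "continuous_on UNIV (\<lambda>t. 3 *\<^sub>R leaf_chain_accel \<omega> (3 * t))"
    by (intro continuous_intros continuous_on_compose2[OF continuous_on_leaf_chain_accel]) auto
qed

lemma propeller_periodic: "leaf_directions \<omega> \<Longrightarrow> propeller \<omega> (t + 1) = propeller \<omega> t"
  using leaf_chain_periodic[of \<omega> 3 "3 * t"] by (simp add: propeller_def leaf_directions_def algebra_simps)

lemma continuous_on_propeller_tangent: "continuous_on S (\<lambda>t. leaf_chain_tangent \<omega> (3 * t))"
  by (rule continuous_on_vector_derivative)
    (rule has_vector_derivative_at_within[OF propeller_tangent_has_vector_derivative])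

lemma norm_propeller_tangent: "leaf_directions \<omega> \<Longrightarrow> norm (leaf_chain_tangent \<omega> x) = 1"
  by (rule norm_leaf_chain_tangent) (auto simp: leaf_directions_def)

lemma immersed_curve_propeller:
  assumes "leaf_directions \<omega>"
  shows "immersed_curve a b (propeller \<omega>)"
  unfolding immersed_curve_def
proof (intro exI conjI ballI)
  show "continuous_on {a..b} (\<lambda>t. leaf_chain_tangent \<omega> (3 * t))"
    by (rule continuous_on_propeller_tangent)
  show "(propeller \<omega> has_vector_derivative leaf_chain_tangent \<omega> (3 * t)) (at t within {a..b})" for t
    by (rule has_vector_derivative_at_within[OF propeller_has_vector_derivative])
  show "leaf_chain_tangent \<omega> (3 * t) \<noteq> 0" for t
    using norm_propeller_tangent[OF assms, of "3 * t"] by auto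
qed

lemma arclength_propeller:
  assumes "leaf_directions \<omega>" "a < b" "t \<in> {a..b}"
  shows "arclength a b (propeller \<omega>) t = t - a"
proof (rule arclength_eq[OF assms(2) _ _ assms(3)])
  show "(propeller \<omega> has_vector_derivative leaf_chain_tangent \<omega> (3 * t)) (at t within {a..b})" for t
    by (rule has_vector_derivative_at_within[OF propeller_has_vector_derivative])
  show "((\<lambda>t. t) has_real_derivative norm (leaf_chain_tangent \<omega> (3 * t))) (at t within {a..b})" for t
    using DERIV_ident by (simp add: norm_propeller_tangent[OF assms(1)])
qed

lemma half_fold_figure_eight_propeller:
  assumes \<omega>: "leaf_directions \<omega>"
  shows "half_fold_figure_eight (of_int j / 3) ((of_int j + 1) / 3) (propeller \<omega> :: real \<Rightarrow> 'a::euclidean_space)"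
    (is "half_fold_figure_eight ?a ?b _")
proof -
  define w w' where "w = \<omega> j" and "w' = \<omega> (j + 1)"
  have w: "norm w = 1" "norm w' = 1" "w \<bullet> w' = cos (2 * phi_star)"
    using \<omega> by (auto simp: w_def w'_def leaf_directions_def)
  have "?a < ?b" by simp
  note len = arclength_propeller[OF \<omega> this]
  have len_eq: "curve_length ?a ?b (propeller \<omega>) = 1 / 3"
    using len[of ?b] by (simp add: field_simps)
  have P: "propeller \<omega> t = (1 / 3) *\<^sub>R leaf w w' (3 * (t - ?a))" if "t \<in> {?a..?b}" for t
  proof -
    have "3 * t \<in> {of_int j..of_int j + 1}" using that by auto
    then show ?thesis by (simp add: propeller_def leaf_chain_eq w_def w'_def right_diff_distrib)
  qed
  have "has_signed_curvature (axis_x w w') (axis_y w w') (1 / 3) (\<lambda>s. (1 / 3) *\<^sub>R leaf w w' (3 * s))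
    (\<lambda>s. 2 * K_star / (1 / 3) * curv (2 * K_star / (1 / 3) * s - K_star))"
    unfolding has_signed_curvature_def
  proof (intro exI[of _ "\<lambda>s. leaf_tangent w w' (3 * s)"] ballI conjI)
    fix s
    have lin: "((\<lambda>s. 3 * s) has_real_derivative 3) (at s within {0..1/3})"
      by (auto intro!: derivative_eq_intros)
    from bounded_linear.has_vector_derivative[OF bounded_linear_scaleR_right
        has_vector_derivative_chain_within[OF lin leaf_has_vector_derivative subset_UNIV], of "1 / 3"]
    show "((\<lambda>s. (1 / 3) *\<^sub>R leaf w w' (3 * s)) has_vector_derivative leaf_tangent w w' (3 * s)) (at s within {0..1/3})"
      by simp
    show "norm (leaf_tangent w w' (3 * s)) = 1" by (rule norm_leaf_tangent[OF w])
    from has_vector_derivative_chain_within[OF lin leaf_tangent_has_vector_derivative subset_UNIV]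
    show "((\<lambda>s. leaf_tangent w w' (3 * s)) has_vector_derivative
        (2 * K_star / (1 / 3) * curv (2 * K_star / (1 / 3) * s - K_star)) *\<^sub>R
        rot90 (axis_x w w') (axis_y w w') (leaf_tangent w w' (3 * s))) (at s within {0..1/3})"
      by (simp add: rot90_leaf_tangent[OF w] leaf_curvature_def mult_ac)
  qed
  moreover have "propeller \<omega> ` {?a..?b} \<subseteq> affine_plane 0 (axis_x w w') (axis_y w w')"
    by (auto simp: P affine_plane_def leaf_def scaleR_add_right)
  moreover have "\<forall>t\<in>{?a..?b}. propeller \<omega> t = (1 / 3) *\<^sub>R leaf w w' (3 * arclength ?a ?b (propeller \<omega>) t)"
    using P len by auto
  ultimately show ?thesis
    unfolding half_fold_figure_eight_def Let_def len_eq curv_eq_jacobi_cn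
    using orthonormal_pair_axes[OF w] immersed_curve_propeller[OF \<omega>] \<open>?a < ?b\<close>
    by (intro conjI exI[of _ "0::'a"] exI[of _ "axis_x w w'"] exI[of _ "axis_y w w'"]
        exI[of _ "\<lambda>s. (1 / 3) *\<^sub>R leaf w w' (3 * s)"])
qed

lemma leaf_partition_propeller:
  assumes "leaf_directions \<omega>"
  shows "leaf_partition 0 1 3 (\<lambda>i. real i / 3) (propeller \<omega>)"
proof -
  have hf: "half_fold_figure_eight (real i / 3) (real (Suc i) / 3) (propeller \<omega>)" for i
    using half_fold_figure_eight_propeller[OF assms, of "int i"] by (simp add: add.commute)
  have len: "curve_length (real i / 3) (real (Suc i) / 3) (propeller \<omega>) = 1 / 3" for i
    by (subst arclength_propeller[OF assms]) (auto simp: divide_right_mono add_divide_distrib)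
  show ?thesis
    by (auto simp: leaf_partition_def len divide_strict_right_mono simp del: of_nat_Suc intro: hf)
qed

lemma elastic_propeller_exists: "\<exists>P. elastic_propeller P"
proof -
  obtain \<omega> :: "int \<Rightarrow> real ^ 3" where \<omega>: "leaf_directions \<omega>" using leaf_directions_exist by blast
  have "closed_H2_curve (propeller \<omega>)"
    unfolding closed_H2_curve_def using propeller_periodic[OF \<omega>] by (simp add: H2_curve_propeller)
  then have "closed_leafed_elastica 3 (propeller \<omega>)"
    unfolding closed_leafed_elastica_def leafed_elastica_def
    using leaf_partition_propeller[OF \<omega>] immersed_curve_propeller[OF \<omega>] H2_curve_propeller[of 0 1]
    by (intro conjI exI[of _ 0]) auto
  moreover have "norm (vector_derivative (propeller \<omega>) (at t)) = 1" for t
    using vector_derivative_at[OF propeller_has_vector_derivative] norm_propeller_tangent[OF \<omega>] by metis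
  moreover have "propeller \<omega> 0 = 0"
    using leaf_chain_of_int(1)[of \<omega> 0] by (simp add: propeller_def)
  moreover have "\<omega> (int i) \<bullet> \<omega> (int j) = cos (2 * phi_star)" if "i \<in> {1..3}" "j \<in> {1..3}" "i \<noteq> j" for i j
  proof -
    have "int i mod 3 = int (i mod 3)" "int j mod 3 = int (j mod 3)" by (simp_all add: zmod_int)
    moreover have "i mod 3 \<noteq> j mod 3" using that by (cases "i = 3"; cases "j = 3") auto
    ultimately show ?thesis
      using leaf_directions_inner[OF \<omega>, of "i mod 3" "j mod 3"]
        leaf_directions_mod[OF \<omega>, of "int i"] leaf_directions_mod[OF \<omega>, of "int j"] by simp
  qed
  moreover have "(propeller \<omega> has_vector_derivative \<omega> (int i)) (at (real i / 3))" for i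
    using propeller_has_vector_derivative[of \<omega> "real i / 3"] leaf_chain_of_int(2)[of \<omega> "int i"] by simp
  ultimately have "elastic_propeller (propeller \<omega>)"
    unfolding elastic_propeller_def
    using leaf_partition_propeller[OF \<omega>] \<omega>
    by (intro conjI exI[of _ "\<lambda>i. \<omega> (int i)"]) (auto simp: leaf_directions_def)
  then show ?thesis by blast
qed

section \<open>Reduction of arbitrary closed three-leafed elasticae to propellers\<close>

lemma elastic_propeller_eq:
  assumes "elastic_propeller P"
  obtains \<omega> where "leaf_directions \<omega>" "P = propeller \<omega>"
proof -
  obtain t\<^sub>0 where H2: "closed_H2_curve P" and imm: "immersed_curve 0 1 (\<lambda>t. P (t + t\<^sub>0))"
    and part: "leaf_partition 0 1 3 (\<lambda>i. real i / 3) P" and "P 0 = 0"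
    and unit: "\<And>t. norm (vector_derivative P (at t)) = 1"
    using assms unfolding elastic_propeller_def closed_leafed_elastica_def leafed_elastica_def by blast
  obtain D where D: "\<And>t. (P has_vector_derivative D t) (at t)" "\<And>t. D t \<noteq> 0" "\<And>t. D (t + 1) = D t"
    using closed_H2_curve_immersed_C1[OF H2 imm] by metis
  have "norm (D t) = 1" for t using unit[of t] vector_derivative_at[OF D(1)] by simp
  \<comment> \<open>At unit speed the identity serves as arclength, which forces L = 1/3.\<close>
  then have "((\<lambda>t. t) has_real_derivative norm (D t)) (at t)" for t using DERIV_ident by simp
  moreover have "D 1 = D 0" using D(3)[of 0] by simp
  ultimately obtain L \<omega> where "leaf_directions \<omega>" "1 - 0 = 3 * L"
    and chain: "\<And>t. t \<in> {0..1} \<Longrightarrow> P t = P 0 + L *\<^sub>R leaf_chain \<omega> ((t - 0) / L)"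
    using leaf_partition_eq_leaf_chain[OF part D(1,2)] by metis
  have L: "L = 1 / 3" using \<open>1 - 0 = 3 * L\<close> by simp
  have "P t = propeller \<omega> t" for t
  proof -
    have "P (frac t) = propeller \<omega> (frac t)"
      using chain[of "frac t"] frac_lt_1[of t] unfolding L \<open>P 0 = 0\<close> by (simp add: propeller_def mult.commute)
    moreover have "P (frac t + of_int \<lfloor>t\<rfloor>) = P (frac t)"
      using H2 by (intro periodic_of_int) (auto simp: closed_H2_curve_def)
    moreover have "propeller \<omega> (frac t + of_int \<lfloor>t\<rfloor>) = propeller \<omega> (frac t)"
      by (intro periodic_of_int propeller_periodic \<open>leaf_directions \<omega>\<close>)
    ultimately show ?thesis by (simp add: frac_def)
  qed
  then show thesis using \<open>leaf_directions \<omega>\<close> that by blast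
qed

lemma closed_leafed_elastica_eq_propeller:
  fixes \<gamma> :: "real \<Rightarrow> 'a::euclidean_space"
  assumes "closed_leafed_elastica 3 \<gamma>"
  obtains r p \<omega> \<phi> where "0 < r" "leaf_directions \<omega>" "circle_reparam \<phi>"
    "\<And>t. \<gamma> t = p + r *\<^sub>R propeller \<omega> (\<phi> t)"
proof -
  obtain t\<^sub>0 c where H2: "closed_H2_curve \<gamma>" and imm: "immersed_curve 0 1 (\<lambda>t. \<gamma> (t + t\<^sub>0))"
    and part: "leaf_partition 0 1 3 c (\<lambda>t. \<gamma> (t + t\<^sub>0))"
    using assms unfolding closed_leafed_elastica_def leafed_elastica_def by blast
  obtain D where D: "continuous_on UNIV D" "\<And>t. (\<gamma> has_vector_derivative D t) (at t)"
      "\<And>t. D t \<noteq> 0" "\<And>t. D (t + 1) = D t"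
    using closed_H2_curve_immersed_C1[OF H2 imm] by metis
  define S where "S = (\<lambda>x. LBINT t=ereal 0..ereal x. norm (D t))"
  have S: "(S has_real_derivative norm (D t)) (at t)" for t
    unfolding S_def by (rule interval_integral_has_real_derivative) (intro continuous_intros D(1))
  have D0: "((\<lambda>t. \<gamma> (t + t\<^sub>0)) has_vector_derivative D (t + t\<^sub>0)) (at t)" for t
    by (rule has_vector_derivative_shift_within[OF D(2)]) auto
  have S0: "((\<lambda>t. S (t + t\<^sub>0)) has_real_derivative norm (D (t + t\<^sub>0))) (at t)" for t
    by (rule DERIV_shift[THEN iffD1, OF S])
  have "D (1 + t\<^sub>0) = D (0 + t\<^sub>0)" using D(4)[of t\<^sub>0] by (simp add: add.commute)
  then obtain L \<omega> where L: "0 < L" "S (1 + t\<^sub>0) - S (0 + t\<^sub>0) = 3 * L" and \<omega>: "leaf_directions \<omega>"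
    and chain: "\<And>t. t \<in> {0..1} \<Longrightarrow> \<gamma> (t + t\<^sub>0) = \<gamma> (0 + t\<^sub>0) + L *\<^sub>R leaf_chain \<omega> ((S (t + t\<^sub>0) - S (0 + t\<^sub>0)) / L)"
    using leaf_partition_eq_leaf_chain[OF part D0 D(3) _ S0] by metis
  \<comment> \<open>Arclength from the seam, divided by the total length 3L, so that one period of
    \<gamma> is one period of the propeller.\<close>
  define \<phi> where "\<phi> = (\<lambda>t. (S t - S t\<^sub>0) / (3 * L))"
  have d\<phi>: "(\<phi> has_real_derivative norm (D t) / (3 * L)) (at t)" for t
    unfolding \<phi>_def using DERIV_cdivide[OF DERIV_diff[OF S DERIV_const]] by simp
  have \<phi>_periodic: "\<phi> (t + 1) = \<phi> t + 1" for t
  proof -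
    have "((\<lambda>t. \<phi> (t + 1) - \<phi> t) has_real_derivative 0) (at t)" for t
      using DERIV_diff[OF DERIV_shift[THEN iffD1, OF d\<phi>[of "t + 1"]] d\<phi>[of t]] by (simp add: D(4))
    then have "\<phi> (t + 1) - \<phi> t = \<phi> (t\<^sub>0 + 1) - \<phi> t\<^sub>0"
      by (rule DERIV_isconst_all[rule_format])
    also have "\<dots> = 1" using L by (simp add: \<phi>_def add.commute)
    finally show ?thesis by simp
  qed
  have "circle_reparam \<phi>"
  proof -
    have "deriv \<phi> = (\<lambda>t. norm (D t) / (3 * L))" by (rule ext, rule DERIV_imp_deriv, rule d\<phi>)
    moreover have "continuous_on UNIV (\<lambda>t. norm (D t) / (3 * L))"
      using L(1) by (intro continuous_intros D(1)) auto
    ultimately show ?thesis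
      unfolding circle_reparam_def field_differentiable_def
      using d\<phi> \<phi>_periodic D(3) L(1) by auto
  qed
  have eq: "\<gamma> t = \<gamma> t\<^sub>0 + (3 * L) *\<^sub>R propeller \<omega> (\<phi> t)" for t
  proof -
    define u where "u = frac (t - t\<^sub>0)"
    have t: "t = u + t\<^sub>0 + of_int \<lfloor>t - t\<^sub>0\<rfloor>" by (simp add: u_def frac_def)
    have "u \<in> {0..1}" using frac_lt_1[of "t - t\<^sub>0"] by (simp add: u_def)
    have "3 * \<phi> (u + t\<^sub>0) = (S (u + t\<^sub>0) - S t\<^sub>0) / L" using L(1) by (simp add: \<phi>_def field_simps)
    from chain[OF \<open>u \<in> {0..1}\<close>] have *: "\<gamma> (u + t\<^sub>0) = \<gamma> t\<^sub>0 + (3 * L) *\<^sub>R propeller \<omega> (\<phi> (u + t\<^sub>0))"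
      using L(1) \<open>3 * \<phi> (u + t\<^sub>0) = (S (u + t\<^sub>0) - S t\<^sub>0) / L\<close> by (simp add: propeller_def)
    have "\<gamma> (u + t\<^sub>0 + of_int \<lfloor>t - t\<^sub>0\<rfloor>) = \<gamma> (u + t\<^sub>0)"
      using H2 by (intro periodic_of_int) (auto simp: closed_H2_curve_def)
    moreover have "propeller \<omega> (\<phi> (u + t\<^sub>0 + of_int \<lfloor>t - t\<^sub>0\<rfloor>)) = propeller \<omega> (\<phi> (u + t\<^sub>0))"
      by (rule periodic_of_int[of "\<lambda>t. propeller \<omega> (\<phi> t)"]) (simp add: \<phi>_periodic propeller_periodic[OF \<omega>])
    ultimately show ?thesis using * t by metis
  qed
  have "0 < 3 * L" using L(1) by simp
  then show thesis by (rule that[OF _ \<omega> \<open>circle_reparam \<phi>\<close> eq])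
qed

lemma propeller_linear: "linear R \<Longrightarrow> R (propeller \<omega> t) = propeller (\<lambda>j. R (\<omega> j)) t"
  by (simp add: propeller_def linear_cmul leaf_chain_linear)

lemma leaf_directions_congruent:
  fixes \<omega> \<omega>' :: "int \<Rightarrow> 'a::euclidean_space"
  assumes "leaf_directions \<omega>" "leaf_directions \<omega>'"
  obtains R where "orthogonal_transformation R" "\<And>j. R (\<omega> j) = \<omega>' j"
proof -
  obtain R where R: "orthogonal_transformation R" "\<And>i. i < 3 \<Longrightarrow> R (\<omega> (int i)) = \<omega>' (int i)"
    using orthogonal_transformation_of_Gram[of 3 "\<lambda>i. \<omega> (int i)" "\<lambda>i. \<omega>' (int i)"]
      leaf_directions_inner[OF assms(1)] leaf_directions_inner[OF assms(2)] by auto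
  have "R (\<omega> j) = \<omega>' j" for j
    using R(2)[of "nat (j mod 3)"] leaf_directions_mod[OF assms(1), of j] leaf_directions_mod[OF assms(2), of j]
    by (simp add: nat_less_iff)
  then show thesis using R(1) that by blast
qed

theorem proposition3p13:
  assumes "3 \<le> CARD('n::finite)"
  shows "(\<exists>P. elastic_propeller P) \<and>
    (\<forall>(\<iota> :: 3 \<Rightarrow> 'n) P. inj \<iota> \<longrightarrow> elastic_propeller P \<longrightarrow>
       closed_leafed_elastica 3 (coord_embedding \<iota> \<circ> P) \<and>
       (\<forall>\<gamma> :: real \<Rightarrow> real ^ 'n. closed_leafed_elastica 3 \<gamma> \<longrightarrow>
          (\<exists>S \<phi>. similarity S \<and> circle_reparam \<phi> \<and>
             \<gamma> = S \<circ> coord_embedding \<iota> \<circ> P \<circ> \<phi>)))"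
proof (intro conjI allI impI)
  show "\<exists>P. elastic_propeller P" by (rule elastic_propeller_exists)
next
  fix \<iota> :: "3 \<Rightarrow> 'n" and P
  assume "inj \<iota>" and P: "elastic_propeller P"
  note J = coord_embedding_isometry[OF \<open>inj \<iota>\<close>]
  show "closed_leafed_elastica 3 (coord_embedding \<iota> \<circ> P)"
    using P by (intro closed_leafed_elastica_isometry J) (simp add: elastic_propeller_def)
  fix \<gamma> :: "real \<Rightarrow> real ^ 'n"
  assume "closed_leafed_elastica 3 \<gamma>"
  then obtain r p \<omega>' \<phi> where "0 < r" "leaf_directions \<omega>'" "circle_reparam \<phi>"
    and \<gamma>: "\<And>t. \<gamma> t = p + r *\<^sub>R propeller \<omega>' (\<phi> t)"
    by (rule closed_leafed_elastica_eq_propeller) metis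
  obtain \<omega> where \<omega>: "leaf_directions \<omega>" "P = propeller \<omega>"
    using elastic_propeller_eq[OF P] .
  \<comment> \<open>The comparison takes place after the embedding: the directions of \<gamma> may
    span a different three-dimensional subspace, and an orthogonal map of the ambient space moves
    one triple to the other.\<close>
  have "leaf_directions (\<lambda>j. coord_embedding \<iota> (\<omega> j))"
    using \<omega>(1) by (simp add: leaf_directions_def J(2) isometry_inner[OF J])
  then obtain R where R: "orthogonal_transformation R" "\<And>j. R (coord_embedding \<iota> (\<omega> j)) = \<omega>' j"
    using leaf_directions_congruent \<open>leaf_directions \<omega>'\<close> by metis
  have "linear R" using R(1) by (simp add: orthogonal_transformation_def)
  define S where "S = (\<lambda>x. p + r *\<^sub>R R x)"
  have "dist (S x) (S y) = r * dist x y" for x y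
    using \<open>0 < r\<close> orthogonal_transformation_norm[OF R(1), of "x - y"]
    by (simp add: S_def dist_norm linear_diff[OF \<open>linear R\<close>] flip: scaleR_diff_right)
  then have "similarity S" unfolding similarity_def using \<open>0 < r\<close> by blast
  moreover have "\<gamma> = S \<circ> coord_embedding \<iota> \<circ> P \<circ> \<phi>"
    by (simp add: fun_eq_iff \<gamma> S_def \<omega>(2) propeller_linear[OF J(1)] propeller_linear[OF \<open>linear R\<close>] R(2))
  ultimately show "\<exists>S \<phi>. similarity S \<and> circle_reparam \<phi> \<and> \<gamma> = S \<circ> coord_embedding \<iota> \<circ> P \<circ> \<phi>"
    using \<open>circle_reparam \<phi>\<close> by blast
qed

end
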